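(* Let $h\in\mathbb{R}[x_1,\ldots,x_n]$ be hyperbolic with respect to $\mathbf{e}\in\mathbb{R}^n$, let $V_1,\ldots,V_m$ be finite sets of vectors in $\Lambda_+(\mathbf{e})$, and let $\mathbf{w}\in\mathbb{R}^{n+m}$. For $\mathbf{V}=(\mathbf{v}_1,\ldots,\mathbf{v}_m)\in V_1\times\cdots\times V_m$ let $f(\mathbf{V};t):=h[\mathbf{v}_1,\ldots,\mathbf{v}_m](t\mathbf{e}+\mathbf{w})$, where $t\mathbf{e}$ denotes $(t\mathbf{e},0,\ldots,0)\in\mathbb{R}^{n+m}$. Then $\{f(\mathbf{V};t)\}_{\mathbf{V}\in V_1\times\cdots\times V_m}$ is a compatible family. In particular, if in addition all vectors in $V_1\cup\cdots\cup V_m$ have rank at most one, and $g(\mathbf{V};t):=h(t\mathbf{e}+\mathbf{w}-\alpha_1\mathbf{v}_1-\cdots-\alpha_m\mathbf{v}_m)$ where $\mathbf{w}\in\mathbb{R}^n$ and $(\alpha_1,\ldots,\alpha_m)\in\mathbb{R}^m$, then $\{g(\mathbf{V};t)\}_{\mathbf{V}\in V_1\times\cdots\times V_m}$ is a compatible family.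
   Context: A homogeneous polynomial $h$ of degree $d$ is hyperbolic with respect to $\mathbf{e}\in\mathbb{R}^n$ if $h(\mathbf{e})\neq0$ and for every $\mathbf{x}\in\mathbb{R}^n$, $t\mapsto h(t\mathbf{e}-\mathbf{x})$ has only real zeros; writing $h(t\mathbf{e}-\mathbf{x})=h(\mathbf{e})\prod_{j=1}^d(t-\lambda_j(\mathbf{x}))$ defines the eigenvalues. $\Lambda_+(\mathbf{e})=\{\mathbf{x}:\min_j\lambda_j(\mathbf{x})\geq0\}$, and $\operatorname{rk}(\mathbf{x})=\#\{j:\lambda_j(\mathbf{x})\neq0\}$. For $\mathbf{v}\in\mathbb{R}^n$, $D_{\mathbf{v}}=\sum_k v_k\partial/\partial x_k$, and $h[\mathbf{v}_1,\ldots,\mathbf{v}_m]:=\prod_{j=1}^m(1-y_jD_{\mathbf{v}_j})\,h(\mathbf{x})\in\mathbb{R}[x_1,\ldots,x_n,y_1,\ldots,y_m]$, viewed as a function on $\mathbb{R}^{n+m}=\mathbb{R}^n\oplus\mathbb{R}^m$. Compatible family: given finite sets $S_1,\ldots,S_m$, a family $\{f(\mathbf{s};t)\}_{\mathbf{s}\in S_1\times\cdots\times S_m}$ of real univariate polynomials in $t$, all of whose non-zero members have the same degree and the same sign of leading coefficient, is compatible if for all choices of independent random variables $\mathsf{X}_1\in S_1,\ldots,\mathsf{X}_m\in S_m$ the polynomial $\mathbb{E}f(\mathsf{X}_1,\ldots,\mathsf{X}_m;t)$ is real-rooted. *)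

theory Defs
  imports "HOL-Analysis.Analysis" "HOL-Computational_Algebra.Polynomial"
begin

definition homog_poly :: "nat \<Rightarrow> (real^'n \<Rightarrow> real) \<Rightarrow> bool" where
  "homog_poly d h \<longleftrightarrow>
     (\<exists>c :: ('n \<Rightarrow> nat) \<Rightarrow> real. \<forall>x.
        h x = (\<Sum>a\<in>{a :: 'n \<Rightarrow> nat. sum a UNIV = d}. c a * (\<Prod>i\<in>UNIV. (x $ i) ^ a i)))"

definition real_rooted :: "real poly \<Rightarrow> bool" where
  "real_rooted p \<longleftrightarrow> p = 0 \<or> (\<forall>z::complex. poly (map_poly complex_of_real p) z = 0 \<longrightarrow> z \<in> \<real>)"

definition hyperbolic :: "(real^'n \<Rightarrow> real) \<Rightarrow> real^'n \<Rightarrow> bool" where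
  "hyperbolic h e \<longleftrightarrow>
     (\<exists>d. homog_poly d h) \<and> h e \<noteq> 0 \<and>
     (\<forall>x. \<exists>p. (\<forall>t. poly p t = h (t *\<^sub>R e - x)) \<and> real_rooted p)"

definition char_poly :: "(real^'n \<Rightarrow> real) \<Rightarrow> real^'n \<Rightarrow> real^'n \<Rightarrow> real poly" where
  "char_poly h e x = (THE p. \<forall>t. poly p t = h (t *\<^sub>R e - x))"

definition eigenvalues :: "(real^'n \<Rightarrow> real) \<Rightarrow> real^'n \<Rightarrow> real^'n \<Rightarrow> real multiset" where
  "eigenvalues h e x = proots (char_poly h e x)"

definition hyp_cone :: "(real^'n \<Rightarrow> real) \<Rightarrow> real^'n \<Rightarrow> (real^'n) set" where
  "hyp_cone h e = {x. \<forall>l \<in># eigenvalues h e x. l \<ge> 0}"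

definition hyp_rank :: "(real^'n \<Rightarrow> real) \<Rightarrow> real^'n \<Rightarrow> real^'n \<Rightarrow> nat" where
  "hyp_rank h e x = size (filter_mset (\<lambda>l. l \<noteq> 0) (eigenvalues h e x))"

definition dir_D :: "real^'n \<Rightarrow> (real^'n \<Rightarrow> real) \<Rightarrow> real^'n \<Rightarrow> real" where
  "dir_D v f x = (\<Sum>k\<in>UNIV. v $ k * deriv (\<lambda>s. f (x + s *\<^sub>R axis k 1)) 0)"

text \<open>h[v_0,...,v_{k-1}] = (1 - y_{k-1} D_{v_{k-1}}) ... (1 - y_0 D_{v_0}) h, as a function
  of x (in R^n) and y (in R^k, given as y :: nat => real, only y 0 .. y (k-1) used).\<close>

fun hbr :: "(real^'n \<Rightarrow> real) \<Rightarrow> (nat \<Rightarrow> real^'n) \<Rightarrow> nat \<Rightarrow> (nat \<Rightarrow> real) \<Rightarrow> real^'n \<Rightarrow> real" where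
  "hbr h V 0 y = h"
| "hbr h V (Suc k) y = (\<lambda>x. hbr h V k y x - y k * dir_D (V k) (hbr h V k y) x)"

text \<open>Compatible family indexed by S_0 x ... x S_{m-1} (tuples = extensional functions
  in PiE {..<m} S).  Independent random variables X_j in S_j are given by their
  distributions p j on S_j; the expectation of f(X;t) is the product-weighted sum.\<close>

definition compatible :: "nat \<Rightarrow> (nat \<Rightarrow> 'a set) \<Rightarrow> ((nat \<Rightarrow> 'a) \<Rightarrow> real poly) \<Rightarrow> bool" where
  "compatible m S f \<longleftrightarrow>
     (\<forall>s\<in>PiE {..<m} S. \<forall>s'\<in>PiE {..<m} S. f s \<noteq> 0 \<and> f s' \<noteq> 0 \<longrightarrow>
        degree (f s) = degree (f s') \<and> sgn (lead_coeff (f s)) = sgn (lead_coeff (f s'))) \<and>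
     (\<forall>p :: nat \<Rightarrow> 'a \<Rightarrow> real.
        (\<forall>j<m. (\<forall>a\<in>S j. p j a \<ge> 0) \<and> (\<Sum>a\<in>S j. p j a) = 1) \<longrightarrow>
        real_rooted (\<Sum>s\<in>PiE {..<m} S. smult (\<Prod>j<m. p j (s j)) (f s)))"

end

theory Submission
  imports Defs "HOL-Computational_Algebra.Fundamental_Theorem_Algebra"
begin

text \<open>Since every factor \<open>1 - y\<^sub>j D\<^bsub>v\<^esub>\<close> is affine in \<open>v\<close>, the expectation of the family is
  the single polynomial \<open>h[u\<^sub>1, \<dots>, u\<^sub>m]\<close> with \<open>u\<^sub>j\<close> the mean of \<open>X\<^sub>j\<close>. The complex extension of \<open>h\<close>
  has no zero with imaginary part in the open convex cone spanned by \<open>e\<close> and the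
  hyperbolicity cone, and by the logarithmic derivative \<open>1 - y D\<^bsub>u\<^esub>\<close> keeps this property for
  real \<open>y\<close> and \<open>u\<close> in the cone. This gives real-rootedness in direction \<open>e\<close>. When \<open>v\<close> has
  rank at most one, \<open>h\<close> is affine along \<open>v\<close>, so \<open>1 - \<alpha> D\<^bsub>v\<^esub>\<close> is translation by \<open>-\<alpha> v\<close>.\<close>

section \<open>Polynomial functions and their complex extensions\<close>

definition ofv :: "real^'n \<Rightarrow> complex^'n" where
  "ofv x = (\<chi> i. complex_of_real (x $ i))"

lemma ofv_nth [simp]: "ofv x $ i = complex_of_real (x $ i)"
  by (simp add: ofv_def)

lemma ofv_add: "ofv (x + y) = ofv x + ofv y"
  by (simp add: vec_eq_iff)

lemma ofv_diff: "ofv (x - y) = ofv x - ofv y"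
  by (simp add: vec_eq_iff)

lemma ofv_scaleR: "ofv (a *\<^sub>R x) = of_real a *s ofv x"
  by (simp add: vec_eq_iff)

lemma ofv_0 [simp]: "ofv 0 = 0"
  by (simp add: vec_eq_iff)

text \<open>\<open>poly_ext k f F\<close>: \<open>f\<close> is a real polynomial function of total degree strictly less than \<open>k\<close>
  (so \<open>f = 0\<close> for \<open>k = 0\<close>), and \<open>F\<close> is the same polynomial on complex arguments.\<close>

inductive poly_ext :: "nat \<Rightarrow> (real^'n \<Rightarrow> real) \<Rightarrow> (complex^'n \<Rightarrow> complex) \<Rightarrow> bool" where
  zero: "poly_ext 0 (\<lambda>_. 0) (\<lambda>_. 0)"
| const: "poly_ext 1 (\<lambda>_. c) (\<lambda>_. complex_of_real c)"
| coord: "poly_ext k f F \<Longrightarrow> poly_ext (Suc k) (\<lambda>x. x $ i * f x) (\<lambda>z. z $ i * F z)"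
| add: "poly_ext k f F \<Longrightarrow> poly_ext k g G \<Longrightarrow> poly_ext k (\<lambda>x. f x + g x) (\<lambda>z. F z + G z)"
| weaken: "poly_ext k f F \<Longrightarrow> poly_ext (Suc k) f F"

lemma poly_ext_0: "poly_ext k f F \<Longrightarrow> k = 0 \<Longrightarrow> f = (\<lambda>_. 0) \<and> F = (\<lambda>_. 0)"
  by (induction rule: poly_ext.induct) auto

lemma poly_ext_zero: "poly_ext k (\<lambda>_. 0) (\<lambda>_. 0)"
  by (induction k) (auto intro: poly_ext.intros)

lemma poly_ext_cmult:
  "poly_ext k f F \<Longrightarrow> poly_ext k (\<lambda>x. c * f x) (\<lambda>z. complex_of_real c * F z)"
proof (induction rule: poly_ext.induct)
  case zero
  show ?case by (simp add: poly_ext.zero)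
next
  case (const c')
  show ?case using poly_ext.const[of "c * c'"] by simp
next
  case (coord k f F i)
  show ?case using poly_ext.coord[OF coord.IH, of i] by (simp add: mult.left_commute)
next
  case (add k f F g G)
  show ?case using poly_ext.add[OF add.IH] by (simp add: distrib_left)
next
  case (weaken k f F)
  show ?case using poly_ext.weaken[OF weaken.IH] .
qed

lemma poly_ext_ofv: "poly_ext k f F \<Longrightarrow> F (ofv x) = of_real (f x)"
  by (induction rule: poly_ext.induct) auto

lemma poly_ext_continuous:
  "poly_ext k f F \<Longrightarrow> continuous_on UNIV F"
  by (induction rule: poly_ext.induct) (auto intro!: continuous_intros)

lemma poly_ext_differentiable:
  fixes f :: "real^'n \<Rightarrow> real"
  shows "poly_ext k f F \<Longrightarrow> f differentiable (at x)"
proof (induction rule: poly_ext.induct)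
  case (coord k f F i)
  have "(\<lambda>x::real^'n. x $ i) differentiable (at x)"
    by (intro bounded_linear_imp_differentiable bounded_linear_vec_nth)
  then show ?case using coord.IH by (rule differentiable_mult)
qed auto

text \<open>The bound is put on coefficients because \<open>k = 0\<close> must force the zero
  polynomial, which a strict bound on \<open>degree\<close> cannot express.\<close>

lemma poly_ext_complex_line:
  "poly_ext k f F \<Longrightarrow> \<exists>p. (\<forall>j\<ge>k. coeff p j = 0) \<and> (\<forall>s. poly p s = F (z + s *s u))"
proof (induction rule: poly_ext.induct)
  case (const c)
  show ?case by (intro exI[of _ "[:of_real c:]"]) (auto simp: coeff_pCons split: nat.splits)
next
  case (coord k f F i)
  then obtain p where p: "\<forall>j\<ge>k. coeff p j = 0" "\<forall>s. poly p s = F (z + s *s u)"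
    by blast
  show ?case
    using p by (intro exI[of _ "[:z $ i, u $ i:] * p"])
      (auto simp: coeff_pCons algebra_simps split: nat.splits)
next
  case (add k f F g G)
  then obtain p q where "\<forall>j\<ge>k. coeff p j = 0" "\<forall>s. poly p s = F (z + s *s u)"
    "\<forall>j\<ge>k. coeff q j = 0" "\<forall>s. poly q s = G (z + s *s u)"
    by blast
  then show ?case by (intro exI[of _ "p + q"]) auto
next
  case (weaken k f F)
  then show ?case by (meson Suc_leD)
qed (auto intro: exI[of _ 0])

text \<open>One real \<open>p\<close> describes both restrictions, so complex roots of
  \<open>p\<close> are zeros of \<open>F\<close> on the complexified line.\<close>

lemma poly_ext_real_line:
  "poly_ext k f F \<Longrightarrow> \<exists>p. (\<forall>j\<ge>k. coeff p j = 0) \<and> (\<forall>s. poly p s = f (x + s *\<^sub>R u))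
     \<and> (\<forall>s. poly (map_poly complex_of_real p) s = F (ofv x + s *s ofv u))"
proof (induction rule: poly_ext.induct)
  case (const c)
  show ?case by (intro exI[of _ "[:c:]"]) (auto simp: coeff_pCons map_poly_pCons split: nat.splits)
next
  case (coord k f F i)
  then obtain p where p: "\<forall>j\<ge>k. coeff p j = 0" "\<forall>s. poly p s = f (x + s *\<^sub>R u)"
    "\<forall>s. poly (map_poly complex_of_real p) s = F (ofv x + s *s ofv u)"
    by blast
  have "map_poly complex_of_real ([:x $ i, u $ i:] * p)
      = [:of_real (x $ i), of_real (u $ i):] * map_poly complex_of_real p"
    by (rule poly_eqI) (simp add: coeff_map_poly coeff_pCons split: nat.splits)
  then show ?case
    using p by (intro exI[of _ "[:x $ i, u $ i:] * p"])
      (auto simp: coeff_pCons algebra_simps split: nat.splits)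
next
  case (add k f F g G)
  then obtain p q where pq: "\<forall>j\<ge>k. coeff p j = 0" "\<forall>s. poly p s = f (x + s *\<^sub>R u)"
    "\<forall>s. poly (map_poly complex_of_real p) s = F (ofv x + s *s ofv u)"
    "\<forall>j\<ge>k. coeff q j = 0" "\<forall>s. poly q s = g (x + s *\<^sub>R u)"
    "\<forall>s. poly (map_poly complex_of_real q) s = G (ofv x + s *s ofv u)"
    by blast
  have "map_poly complex_of_real (p + q) = map_poly complex_of_real p + map_poly complex_of_real q"
    by (rule poly_eqI) (simp add: coeff_map_poly)
  then show ?case using pq by (intro exI[of _ "p + q"]) auto
next
  case (weaken k f F)
  then show ?case by (meson Suc_leD)
qed (auto intro: exI[of _ 0])

section \<open>Directional derivatives\<close>

lemma dir_D_has_derivative: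
  assumes "f differentiable (at x)"
  shows "((\<lambda>s. f (x + s *\<^sub>R v)) has_real_derivative dir_D v f x) (at 0)"
proof -
  obtain L where L: "(f has_derivative L) (at x)"
    using assms by (auto simp: differentiable_def)
  have lin: "linear L" using has_derivative_linear[OF L] .
  have line: "((\<lambda>s. f (x + s *\<^sub>R w)) has_real_derivative L w) (at 0)" for w
  proof -
    have "((\<lambda>s. x + s *\<^sub>R w) has_derivative (\<lambda>s. s *\<^sub>R w)) (at (0::real))"
      by (auto intro!: derivative_eq_intros)
    then have "((\<lambda>s. f (x + s *\<^sub>R w)) has_derivative (\<lambda>s. L (s *\<^sub>R w))) (at 0)"
      by (rule has_derivative_compose) (simp add: L)
    then show ?thesis
      using lin by (simp add: has_field_derivative_def linear_cmul mult.commute[of _ "L w"])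
  qed
  have "dir_D v f x = (\<Sum>k\<in>UNIV. v $ k * L (axis k 1))"
    unfolding dir_D_def using DERIV_imp_deriv[OF line] by simp
  also have "\<dots> = L (\<Sum>k\<in>UNIV. v $ k *\<^sub>R axis k 1)"
    using lin by (simp add: linear_sum linear_cmul)
  also have "(\<Sum>k\<in>UNIV. v $ k *\<^sub>R axis k 1) = v"
    using basis_expansion[of v] by (simp add: scalar_mult_eq_scaleR)
  finally show ?thesis using line by simp
qed

text \<open>Linearity in the direction is read off the defining sum; it is what lets
  \<open>hbr_expectation\<close> replace random vectors by their means.\<close>

lemma dir_D_scaleR_sum:
  "dir_D (\<Sum>a\<in>A. c a *\<^sub>R a) f x = (\<Sum>a\<in>A. c a * dir_D a f x)"
  unfolding dir_D_def
  by (simp add: sum_distrib_left sum_distrib_right mult.assoc)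
    (rule sum.swap)

lemma dir_D_sum:
  assumes "finite A" "\<And>s. s \<in> A \<Longrightarrow> f s differentiable (at x)"
  shows "dir_D v (\<lambda>x. \<Sum>s\<in>A. c s * f s x) x = (\<Sum>s\<in>A. c s * dir_D v (f s) x)"
proof -
  have "(\<lambda>x. \<Sum>s\<in>A. c s * f s x) differentiable (at x)"
    using assms by (intro differentiable_sum differentiable_mult) auto
  note this[THEN dir_D_has_derivative, of v]
  moreover have "((\<lambda>t. \<Sum>s\<in>A. c s * f s (x + t *\<^sub>R v)) has_real_derivative
      (\<Sum>s\<in>A. c s * dir_D v (f s) x)) (at 0)"
    using assms dir_D_has_derivative
    by (intro DERIV_sum DERIV_cmult) auto
  ultimately show ?thesis by (rule DERIV_unique)
qed

lemma dir_D_translate: "dir_D v (\<lambda>x. f (x - c)) x = dir_D v f (x - c)"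
  by (simp add: dir_D_def algebra_simps)

lemma poly_ext_dir_D:
  assumes "poly_ext k f F"
  shows "\<exists>G. poly_ext (k - 1) (dir_D v f) G \<and>
    (\<forall>z. ((\<lambda>s. F (z + s *s ofv v)) has_field_derivative G z) (at 0))"
proof -
  \<comment> \<open>The induction uses derivatives along lines, where the sum and product rules
    apply; uniqueness of derivatives identifies \<open>g\<close> with \<open>dir_D v f\<close>
    afterwards.\<close>
  have "\<exists>g G. poly_ext (k - 1) g G \<and>
    (\<forall>z. ((\<lambda>s. F (z + s *s ofv v)) has_field_derivative G z) (at 0)) \<and>
    (\<forall>x. ((\<lambda>s. f (x + s *\<^sub>R v)) has_field_derivative g x) (at 0))"
    using assms
  proof (induction rule: poly_ext.induct)
    case zero
    show ?case
      using poly_ext.zero by (intro exI[of _ "\<lambda>_. 0"]) simp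
  next
    case (const c)
    show ?case
      using poly_ext.zero by (intro exI[of _ "\<lambda>_. 0"]) simp
  next
    case (coord k f F i)
    then obtain g G where gG: "poly_ext (k - 1) g G"
      and dG: "\<And>z. ((\<lambda>s. F (z + s *s ofv v)) has_field_derivative G z) (at 0)"
      and dg: "\<And>x. ((\<lambda>s. f (x + s *\<^sub>R v)) has_field_derivative g x) (at 0)"
      by blast
    \<comment> \<open>Truncated subtraction makes \<open>k = 0\<close> exceptional:
      \<open>Suc (k - 1)\<close> is then not \<open>k\<close>, but \<open>g\<close> and
      \<open>G\<close> are zero.\<close>
    have "poly_ext k (\<lambda>x. x $ i * g x) (\<lambda>z. z $ i * G z)"
    proof (cases k)
      case 0
      then show ?thesis using poly_ext_0[OF gG] poly_ext.zero by simp
    next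
      case (Suc k')
      then show ?thesis using poly_ext.coord[OF gG, of i] by simp
    qed
    with poly_ext_cmult[OF coord.hyps, of "v $ i"]
    have "poly_ext k (\<lambda>x. v $ i * f x + x $ i * g x)
        (\<lambda>z. of_real (v $ i) * F z + z $ i * G z)"
      by (rule poly_ext.add)
    moreover have "((\<lambda>s. (z + s *s ofv v) $ i * F (z + s *s ofv v)) has_field_derivative
        of_real (v $ i) * F z + z $ i * G z) (at 0)" for z
      by (auto intro!: derivative_eq_intros dG)
    moreover have "((\<lambda>s. (x + s *\<^sub>R v) $ i * f (x + s *\<^sub>R v)) has_field_derivative
        v $ i * f x + x $ i * g x) (at 0)" for x
      by (auto intro!: derivative_eq_intros dg)
    ultimately show ?case by force
  next
    case (add k f F g G)
    then obtain g1 G1 g2 G2 where "poly_ext (k - 1) g1 G1" "poly_ext (k - 1) g2 G2"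
      and "\<And>z. ((\<lambda>s. F (z + s *s ofv v)) has_field_derivative G1 z) (at 0)"
      "\<And>x. ((\<lambda>s. f (x + s *\<^sub>R v)) has_field_derivative g1 x) (at 0)"
      "\<And>z. ((\<lambda>s. G (z + s *s ofv v)) has_field_derivative G2 z) (at 0)"
      "\<And>x. ((\<lambda>s. g (x + s *\<^sub>R v)) has_field_derivative g2 x) (at 0)"
      by blast
    then show ?case
      by (intro exI[of _ "\<lambda>x. g1 x + g2 x"] exI[of _ "\<lambda>z. G1 z + G2 z"])
        (auto intro: poly_ext.add DERIV_add)
  next
    case (weaken k f F)
    then obtain g G where gG: "poly_ext (k - 1) g G"
      and d: "\<forall>z. ((\<lambda>s. F (z + s *s ofv v)) has_field_derivative G z) (at 0)"
      "\<forall>x. ((\<lambda>s. f (x + s *\<^sub>R v)) has_field_derivative g x) (at 0)"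
      by blast
    have "poly_ext k g G"
      using gG poly_ext.weaken[OF gG] by (cases k) auto
    then show ?case using d by auto
  qed
  then obtain g G where *: "poly_ext (k - 1) g G"
    "\<forall>z. ((\<lambda>s. F (z + s *s ofv v)) has_field_derivative G z) (at 0)"
    "\<And>x. ((\<lambda>s. f (x + s *\<^sub>R v)) has_field_derivative g x) (at 0)"
    by blast
  have "g = dir_D v f"
    using DERIV_unique[OF *(3) dir_D_has_derivative[OF poly_ext_differentiable[OF assms]]] by auto
  with * show ?thesis by blast
qed

lemma poly_ext_monomial:
  assumes "finite I"
  shows "poly_ext (Suc (\<Sum>i\<in>I. a i)) (\<lambda>x. \<Prod>i\<in>I. (x $ i) ^ a i) (\<lambda>z. \<Prod>i\<in>I. (z $ i) ^ a i)"
  using assms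
proof (induction I)
  case empty
  show ?case using poly_ext.const[of 1] by simp
next
  case (insert i I)
  have "poly_ext (n + Suc (\<Sum>i\<in>I. a i)) (\<lambda>x. x $ i ^ n * (\<Prod>i\<in>I. (x $ i) ^ a i))
      (\<lambda>z. z $ i ^ n * (\<Prod>i\<in>I. (z $ i) ^ a i))" for n
  proof (induction n)
    case 0
    show ?case using insert.IH by simp
  next
    case (Suc n)
    show ?case using poly_ext.coord[OF Suc.IH, of i] by (simp add: mult.assoc)
  qed
  from this[of "a i"] show ?case using insert by simp
qed

lemma homog_poly_ext:
  fixes h :: "real^'n \<Rightarrow> real"
  assumes "homog_poly d h"
  shows "\<exists>H. poly_ext (Suc d) h H \<and> (\<forall>c z. H (c *s z) = c ^ d * H z)"
proof -
  obtain c where c: "\<And>x. h x =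
      (\<Sum>a\<in>{a :: 'n \<Rightarrow> nat. sum a UNIV = d}. c a * (\<Prod>i\<in>UNIV. (x $ i) ^ a i))"
    using assms by (auto simp: homog_poly_def)
  have "poly_ext (Suc d) (\<lambda>x. \<Sum>a\<in>A. c a * (\<Prod>i\<in>UNIV. (x $ i) ^ a i))
     (\<lambda>z. \<Sum>a\<in>A. of_real (c a) * (\<Prod>i\<in>UNIV. (z $ i) ^ a i))"
    if "A \<subseteq> {a :: 'n \<Rightarrow> nat. sum a UNIV = d}" for A
    using that
  \<comment> \<open>Infinite \<open>A\<close> is a case of this induction, with both sums 0 by
    convention; this replaces a finiteness proof for the set of exponents.\<close>
  proof (induction A rule: infinite_finite_induct)
    case (insert a A)
    then have "poly_ext (Suc d) (\<lambda>x. c a * (\<Prod>i\<in>UNIV. (x $ i) ^ a i))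
       (\<lambda>z. of_real (c a) * (\<Prod>i\<in>UNIV. (z $ i) ^ a i))"
      using poly_ext_cmult[OF poly_ext_monomial[of UNIV a]] by auto
    then show ?case using insert by (simp add: poly_ext.add)
  qed (simp_all add: poly_ext_zero)
  then have "poly_ext (Suc d) h
     (\<lambda>z. \<Sum>a | sum a UNIV = d. of_real (c a) * (\<Prod>i\<in>UNIV. (z $ i) ^ a i))"
    unfolding c[abs_def] by blast
  moreover have "(\<Sum>a | sum a UNIV = d. complex_of_real (c a) * (\<Prod>i\<in>UNIV. ((b *s z) $ i) ^ a i))
      = b ^ d * (\<Sum>a | sum a UNIV = d. of_real (c a) * (\<Prod>i\<in>UNIV. (z $ i) ^ a i))"
    for b and z :: "complex^'n"
    unfolding sum_distrib_left
    by (rule sum.cong) (auto simp: power_mult_distrib prod.distrib power_sum)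
  ultimately show ?thesis by blast
qed

section \<open>Zeros of univariate polynomials\<close>

text \<open>The fundamental theorem of algebra as an induction over linear factors, so that
  estimates can treat one root at a time.\<close>

lemma complex_poly_root_induct [consumes 1, case_names const root]:
  fixes p :: "complex poly"
  assumes "p \<noteq> 0"
    and const: "\<And>c. c \<noteq> 0 \<Longrightarrow> P [:c:]"
    and root: "\<And>r p. p \<noteq> 0 \<Longrightarrow> P p \<Longrightarrow> P ([:- r, 1:] * p)"
  shows "P p"
  using \<open>p \<noteq> 0\<close>
proof (induction "degree p" arbitrary: p)
  case 0
  then show ?case using const by (metis degree_eq_zeroE pCons_eq_0_iff)
next
  case (Suc n)
  then obtain r where "poly p r = 0"
    using fundamental_theorem_of_algebra constant_degree by (metis nat.distinct(1))
  then obtain q where q: "p = [:- r, 1:] * q"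
    by (metis dvdE poly_eq_0_iff_dvd)
  with \<open>p \<noteq> 0\<close> have "q \<noteq> 0" by auto
  then have "degree p = Suc (degree q)"
    unfolding q by (subst degree_mult_eq) auto
  then show ?case
    using Suc q \<open>q \<noteq> 0\<close> root by simp
qed

text \<open>Each linear factor satisfies |s - r| >= Im s - Im r >= Im s. Absence of roots in the
  open upper half plane thus becomes a non-strict inequality, which survives limits.\<close>

lemma norm_poly_ge_Im_power:
  fixes p :: "complex poly"
  assumes "p \<noteq> 0" "\<And>r. poly p r = 0 \<Longrightarrow> Im r \<le> 0" "Im s > 0"
  shows "norm (poly p s) \<ge> norm (lead_coeff p) * Im s ^ degree p"
  using assms(1,2)
proof (induction p rule: complex_poly_root_induct)
  case (root r p)
  have "Im s \<le> Im s - Im r"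
    using root.prems[of r] by simp
  also have "\<dots> \<le> norm (s - r)"
    using abs_Im_le_cmod[of "s - r"] by simp
  finally have "Im s \<le> norm (s - r)" .
  moreover have "norm (lead_coeff p) * Im s ^ degree p \<le> norm (poly p s)"
    using root by simp
  ultimately have "Im s * (norm (lead_coeff p) * Im s ^ degree p) \<le> norm (s - r) * norm (poly p s)"
    using assms(3) by (intro mult_mono) auto
  moreover have "degree ([:- r, 1:] * p) = Suc (degree p)"
    using \<open>p \<noteq> 0\<close> by (subst degree_mult_eq) auto
  moreover have "lead_coeff ([:- r, 1:] * p) = lead_coeff p"
    by (subst lead_coeff_mult) simp
  moreover have "norm (poly ([:- r, 1:] * p) s) = norm (s - r) * norm (poly p s)"
    by (simp flip: norm_mult) (simp add: algebra_simps)
  ultimately show ?case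
    by (simp only: power_Suc) (simp add: mult_ac)
qed simp

text \<open>Each factor satisfies |s - r| <= |r| (1 + T |s|), and the moduli |r| together with the
  leading coefficient multiply up to |p(0)|.\<close>

lemma norm_poly_le_of_roots_away:
  fixes p :: "complex poly"
  assumes "p \<noteq> 0" "T > 0" "\<And>r. poly p r = 0 \<Longrightarrow> T * norm r \<ge> 1"
  shows "norm (poly p s) \<le> norm (poly p 0) * (1 + T * norm s) ^ degree p"
  using assms(1,3)
proof (induction p rule: complex_poly_root_induct)
  case (root r p)
  have "norm (s - r) \<le> norm r + norm s * 1"
    using norm_triangle_ineq4[of s r] by simp
  also have "\<dots> \<le> norm r + norm s * (T * norm r)"
    using root.prems[of r] by (intro add_mono mult_left_mono) auto
  finally have "norm (s - r) \<le> norm r * (1 + T * norm s)"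
    by (simp add: algebra_simps)
  moreover have "norm (poly p s) \<le> norm (poly p 0) * (1 + T * norm s) ^ degree p"
    using root by simp
  ultimately have "norm (s - r) * norm (poly p s)
      \<le> (norm r * (1 + T * norm s)) * (norm (poly p 0) * (1 + T * norm s) ^ degree p)"
    using \<open>T > 0\<close> by (intro mult_mono) auto
  moreover have "degree ([:- r, 1:] * p) = Suc (degree p)"
    using \<open>p \<noteq> 0\<close> by (subst degree_mult_eq) auto
  moreover have "norm (poly ([:- r, 1:] * p) x) = norm (x - r) * norm (poly p x)" for x
    by (simp flip: norm_mult) (simp add: algebra_simps)
  ultimately show ?case
    by (simp only: norm_minus_commute[of 0 r]) (simp add: mult_ac)
qed simp

text \<open>The logarithmic derivative at 0 is the sum of -1/r over the roots r, and each term has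
  negative imaginary part. The first alternative covers constants.\<close>

lemma Im_log_deriv_neg:
  fixes p :: "complex poly"
  assumes "p \<noteq> 0" "\<And>r. poly p r = 0 \<Longrightarrow> Im r < 0"
  shows "poly (pderiv p) 0 = 0 \<or> Im (poly (pderiv p) 0 / poly p 0) < 0"
  using assms
proof (induction p rule: complex_poly_root_induct)
  case (root r p)
  have r: "Im r < 0" using root.prems[of r] by simp
  have p0: "poly p 0 \<noteq> 0" using root.prems[of 0] by auto
  have "r \<noteq> 0" using r by auto
  then have "poly (pderiv ([:- r, 1:] * p)) 0 / poly ([:- r, 1:] * p) 0
      = poly (pderiv p) 0 / poly p 0 - 1 / r"
    using p0 by (subst pderiv_mult) (simp add: pderiv_pCons field_simps)
  moreover have "Im (1 / r) > 0"
    using r \<open>r \<noteq> 0\<close> by (simp add: Im_divide divide_less_0_iff sum_power2_gt_zero_iff zero_less_divide_iff)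
  moreover have "Im (poly (pderiv p) 0 / poly p 0) \<le> 0"
    using root by auto
  ultimately show ?case by simp
qed (simp add: pderiv_pCons)

text \<open>Otherwise the logarithmic derivative at 0 would be the real number 1/y, against
  \<open>Im_log_deriv_neg\<close>.\<close>

lemma poly_minus_deriv_nonzero:
  fixes p :: "complex poly" and y :: real
  assumes "\<And>r. Im r \<ge> 0 \<Longrightarrow> poly p r \<noteq> 0"
  shows "poly p 0 - of_real y * poly (pderiv p) 0 \<noteq> 0"
proof
  assume *: "poly p 0 - of_real y * poly (pderiv p) 0 = 0"
  have p0: "poly p 0 \<noteq> 0" using assms by simp
  with * have "poly (pderiv p) 0 / poly p 0 = of_real (1 / y)" "poly (pderiv p) 0 \<noteq> 0"
    by (auto simp: field_simps)
  moreover have "p \<noteq> 0" using p0 by auto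
  ultimately show False
    using Im_log_deriv_neg[of p] assms by (metis Im_complex_of_real less_irrefl linorder_not_le)
qed

section \<open>Real-rootedness and growth of real polynomials\<close>

lemma map_poly_of_real_mult:
  "map_poly complex_of_real (p * q) = map_poly complex_of_real p * map_poly complex_of_real q"
  by (rule poly_eqI) (simp add: coeff_map_poly coeff_mult)

lemma poly_map_of_real: "poly (map_poly complex_of_real p) (of_real t) = of_real (poly p t)"
  by (induction p) (auto simp: map_poly_pCons)

lemma poly_map_of_real_cnj:
  "poly (map_poly complex_of_real p) (cnj z) = cnj (poly (map_poly complex_of_real p) z)"
  by (induction p) (auto simp: map_poly_pCons)

lemma real_rooted_split:
  assumes "p \<noteq> 0" "real_rooted p"
  shows "\<exists>c. p = smult c (\<Prod>l\<in>#proots p. [:- l, 1:])"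
  using assms
proof (induction "degree p" arbitrary: p)
  case 0
  then obtain c where "p = [:c:]" by (metis degree_eq_zeroE)
  then show ?case by (intro exI[of _ c]) simp
next
  case (Suc n)
  have "degree (map_poly complex_of_real p) = degree p"
    by (rule degree_map_poly) auto
  then obtain z where z: "poly (map_poly complex_of_real p) z = 0"
    using Suc fundamental_theorem_of_algebra constant_degree by (metis nat.distinct(1))
  with Suc.prems obtain r where "z = of_real r"
    unfolding real_rooted_def by (meson Reals_cases)
  with z have "poly p r = 0" by (simp add: poly_map_of_real)
  then obtain q where q: "p = [:- r, 1:] * q"
    by (metis dvdE poly_eq_0_iff_dvd)
  with \<open>p \<noteq> 0\<close> have "q \<noteq> 0" by auto
  have "degree p = Suc (degree q)"
    unfolding q using \<open>q \<noteq> 0\<close> by (subst degree_mult_eq) auto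
  moreover have "real_rooted q"
    using Suc.prems unfolding real_rooted_def q map_poly_of_real_mult by auto
  ultimately obtain c where c: "q = smult c (\<Prod>l\<in>#proots q. [:- l, 1:])"
    using Suc \<open>q \<noteq> 0\<close> by auto
  have "proots p = add_mset r (proots q)"
    unfolding q using \<open>q \<noteq> 0\<close> by (subst proots_mult) auto
  then show ?case
    using c q by (metis image_mset_add_mset mult_smult_right prod_mset.add_mset)
qed

lemma degree_le_1_of_linear_growth:
  fixes p :: "real poly"
  assumes "\<And>s. s > 0 \<Longrightarrow> \<bar>poly p s\<bar> \<le> C * (1 + s)"
  shows "degree p \<le> 1"
proof (rule ccontr)
  assume deg: "\<not> degree p \<le> 1"
  have pos: False if deg: "\<not> degree q \<le> 1" and lc: "lead_coeff q > 0"
    and le: "\<And>s. s > 0 \<Longrightarrow> \<bar>poly q s\<bar> \<le> C * (1 + s)" for q :: "real poly"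
  proof -
    \<comment> \<open>Splitting off two coefficients gives q(s) = a + b s + s^2 r(s), with
      \<open>r\<close> nonzero and of the same leading coefficient.\<close>
    obtain a b r where q: "q = pCons a (pCons b r)" by (metis pCons_cases)
    have r: "r \<noteq> 0" "lead_coeff r = lead_coeff q" using deg by (auto simp: q split: if_splits)
    then obtain n where n: "\<And>x. x \<ge> n \<Longrightarrow> poly r x \<ge> lead_coeff r"
      using poly_pinfty_gt_lc[of r] lc by metis
    define l where "l = lead_coeff r"
    have l: "l > 0" using r lc by (simp add: l_def)
    \<comment> \<open>Large enough that r(s) >= l and that s^2 r(s) exceeds all other terms; the
      factor 2 on \<open>C\<close> comes from 1 + s <= 2 s.\<close>
    define s where "s = max 1 (max n ((2 * C + \<bar>a\<bar> + \<bar>b\<bar> + 1) / l))"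
    have s: "s \<ge> 1" "s \<ge> n" "s * l \<ge> 2 * C + \<bar>a\<bar> + \<bar>b\<bar> + 1"
      using l unfolding s_def by (auto simp: pos_divide_le_eq[symmetric])
    have C: "C \<ge> 0" using le[of 1] abs_ge_zero[of "poly q 1"] by simp
    have "s * (2 * C + \<bar>a\<bar> + \<bar>b\<bar> + 1) \<le> s * (s * l)"
      using s by (intro mult_left_mono) auto
    also have "\<dots> \<le> s * (s * poly r s)"
      using n[OF s(2)] s by (intro mult_left_mono) (auto simp: l_def)
    also have "\<dots> = poly q s - a - s * b" by (simp add: q algebra_simps)
    also have "\<dots> \<le> C * (1 + s) + s * \<bar>a\<bar> + s * \<bar>b\<bar>"
    proof -
      have "- a \<le> s * \<bar>a\<bar>" using s mult_right_mono[of 1 s "\<bar>a\<bar>"] by linarith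
      moreover have "s * (- b) \<le> s * \<bar>b\<bar>" using s by (intro mult_left_mono) auto
      ultimately show ?thesis using le[of s] s by simp
    qed
    also have "\<dots> \<le> s * (2 * C + \<bar>a\<bar> + \<bar>b\<bar>)"
      using mult_left_mono[OF s(1) C] by (simp add: algebra_simps)
    finally show False using s by (simp add: algebra_simps)
  qed
  show False
  proof (cases "lead_coeff p > 0")
    case True
    then show ?thesis using pos[OF deg] assms by blast
  next
    case False
    moreover have "lead_coeff p \<noteq> 0" using deg by auto
    ultimately have "lead_coeff (- p) > 0" by (auto simp: not_less le_less)
    then show ?thesis using pos[of "- p"] deg assms by simp
  qed
qed

section \<open>The hyperbolicity cone\<close>

lemma continuous_on_ofv [continuous_intros]:
  "continuous_on S f \<Longrightarrow> continuous_on S (\<lambda>x. ofv (f x))"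
  unfolding ofv_def by (intro continuous_intros)

lemma continuous_on_smult_vec [continuous_intros]:
  fixes g :: "'a::topological_space \<Rightarrow> complex^'n"
  shows "continuous_on S c \<Longrightarrow> continuous_on S g \<Longrightarrow> continuous_on S (\<lambda>x. c x *s g x)"
  unfolding vector_scalar_mult_def by (intro continuous_intros)

lemma norm_smult_vec: "norm (c *s (z :: complex^'n)) = norm c * norm z"
  by (simp add: norm_vec_def norm_mult L2_set_left_distrib[symmetric] L2_set_right_distrib)

text \<open>By homogeneity F(z + s u) = s^d F(u + z/s): exchanging base point and direction reverses
  the coefficients, so the coefficient of s^d is the constant term F(u).\<close>

lemma poly_ext_homog_line:
  assumes ext: "poly_ext (Suc d) f F" and homog: "\<And>c z. F (c *s z) = c ^ d * F z"
  shows "\<exists>p. (\<forall>j>d. coeff p j = 0) \<and> coeff p d = F u \<and> (\<forall>s. poly p s = F (z + s *s u))"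
proof -
  obtain p where p: "\<forall>j\<ge>Suc d. coeff p j = 0" "\<And>s. poly p s = F (z + s *s u)"
    using poly_ext_complex_line[OF ext] by metis
  obtain r where r: "\<forall>j\<ge>Suc d. coeff r j = 0" "\<And>s. poly r s = F (u + s *s z)"
    using poly_ext_complex_line[OF ext] by metis
  \<comment> \<open>The reversal of \<open>r\<close>; it agrees with \<open>p\<close> at all nonzero
    arguments, hence everywhere.\<close>
  define q where "q = (\<Sum>k\<le>d. monom (coeff r k) (d - k))"
  have "degree r \<le> d" using r(1) by (intro degree_le) auto
  then have r_sum: "poly r s = (\<Sum>k\<le>d. coeff r k * s ^ k)" for s
    using r(1) unfolding poly_altdef
    by (intro sum.mono_neutral_left) (auto simp: coeff_eq_0)
  have "poly p s = poly q s" if "s \<noteq> 0" for s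
  proof -
    have *: "z + s *s u = s *s (u + inverse s *s z)"
      using that by (simp add: vec_eq_iff distrib_left)
    have "poly p s = s ^ d * poly r (inverse s)"
      unfolding p(2) r(2) by (subst *) (simp only: homog)
    also have "\<dots> = poly q s"
      unfolding r_sum q_def poly_sum poly_monom sum_distrib_left
      using that by (intro sum.cong) (auto simp: power_diff field_simps)
    finally show ?thesis .
  qed
  then have "UNIV - {0} \<subseteq> {s. poly (p - q) s = 0}" by auto
  moreover have "infinite (UNIV - {0::complex})"
    by (simp add: infinite_UNIV_char_0)
  ultimately have "p = q"
    using poly_roots_finite[of "p - q"] by (meson eq_iff_diff_eq_0 finite_subset)
  have "coeff q d = (\<Sum>k\<le>d. if k = 0 then coeff r 0 else 0)"
    unfolding q_def coeff_sum by (intro sum.cong) (auto simp: coeff_monom)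
  also have "\<dots> = coeff r 0" by simp
  also have "\<dots> = F u" using r(2)[of 0] by (simp add: poly_0_coeff_0)
  finally show ?thesis using p \<open>p = q\<close> by (metis Suc_leI)
qed

section \<open>Hyperbolic polynomials and their characteristic polynomials\<close>

locale hyperbolic_ext =
  fixes h :: "real^'n \<Rightarrow> real" and H :: "complex^'n \<Rightarrow> complex" and e :: "real^'n" and d :: nat
  assumes ext: "poly_ext (Suc d) h H"
    and homog: "H (c *s z) = c ^ d * H z"
    and h_e: "h e \<noteq> 0"
    and hyp: "\<exists>p. (\<forall>t. poly p t = h (t *\<^sub>R e - x)) \<and> real_rooted p"
begin

lemma H_ofv [simp]: "H (ofv x) = of_real (h x)"
  using poly_ext_ofv[OF ext] .

lemma real_homog: "h (c *\<^sub>R x) = c ^ d * h x"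
proof -
  have "complex_of_real (h (c *\<^sub>R x)) = of_real (c ^ d * h x)"
    using homog[of "of_real c" "ofv x"] unfolding ofv_scaleR[symmetric] H_ofv by simp
  then show ?thesis by (simp only: of_real_eq_iff)
qed

lemma real_line:
  "\<exists>p. (\<forall>j>d. coeff p j = 0) \<and> coeff p d = h u \<and> (\<forall>s. poly p s = h (x + s *\<^sub>R u))
     \<and> (\<forall>s. poly (map_poly complex_of_real p) s = H (ofv x + s *s ofv u))"
proof -
  obtain p where p: "\<forall>j\<ge>Suc d. coeff p j = 0" "\<forall>s. poly p s = h (x + s *\<^sub>R u)"
      "\<forall>s. poly (map_poly complex_of_real p) s = H (ofv x + s *s ofv u)"
    using poly_ext_real_line[OF ext] by metis
  obtain q where q: "coeff q d = H (ofv u)" "\<forall>s. poly q s = H (ofv x + s *s ofv u)"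
    using poly_ext_homog_line[OF ext homog] by metis
  have "map_poly complex_of_real p = q"
    using p q by (simp add: poly_eq_poly_eq_iff[symmetric] fun_eq_iff)
  then have "complex_of_real (coeff p d) = of_real (h u)"
    using q by (auto simp: coeff_map_poly)
  then show ?thesis using p by (auto simp: Suc_le_eq)
qed

lemma char_poly_unique:
  assumes "\<forall>t. poly p t = h (t *\<^sub>R e - x)"
  shows "char_poly h e x = p"
  unfolding char_poly_def using assms
  by (intro the_equality) (auto simp: poly_eq_poly_eq_iff[symmetric])

lemma char_poly_props:
  shows poly_char_poly: "poly (char_poly h e x) t = h (t *\<^sub>R e - x)"
    and poly_map_char_poly: "poly (map_poly of_real (char_poly h e x)) s = H (s *s ofv e - ofv x)"
    and real_rooted_char_poly: "real_rooted (char_poly h e x)"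
    and char_poly_nonzero: "char_poly h e x \<noteq> 0"
    and degree_char_poly: "degree (char_poly h e x) = d"
proof -
  obtain p where p: "\<forall>j>d. coeff p j = 0" "coeff p d = h e" "\<forall>s. poly p s = h (- x + s *\<^sub>R e)"
     "\<forall>s. poly (map_poly complex_of_real p) s = H (ofv (- x) + s *s ofv e)"
    using real_line by metis
  have cp: "char_poly h e x = p"
    using p(3) by (intro char_poly_unique) simp
  show "poly (char_poly h e x) t = h (t *\<^sub>R e - x)" using cp p by simp
  have "ofv (- x) + s *s ofv e = s *s ofv e - ofv x" by (simp add: vec_eq_iff)
  then show "poly (map_poly of_real (char_poly h e x)) s = H (s *s ofv e - ofv x)"
    using cp p by simp
  show "real_rooted (char_poly h e x)" using hyp[of x] char_poly_unique by metis
  show "char_poly h e x \<noteq> 0" using cp p h_e by auto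
  show "degree (char_poly h e x) = d"
    unfolding cp using p h_e by (intro antisym degree_le le_degree) auto
qed

lemma hyp_coneD:
  assumes "v \<in> hyp_cone h e" "h (t *\<^sub>R e - v) = 0"
  shows "t \<ge> 0"
  using assms char_poly_nonzero[of v] poly_char_poly[of v t]
  by (auto simp: hyp_cone_def eigenvalues_def)

lemma H_line_real:
  assumes "H (t *s ofv e - ofv x) = 0"
  shows "t \<in> \<real>"
  using assms real_rooted_char_poly[of x] char_poly_nonzero[of x] poly_map_char_poly[of x t]
  by (auto simp: real_rooted_def)

section \<open>Directions of hyperbolicity and admissible vectors\<close>

text \<open>For homogeneous \<open>h\<close> this is hyperbolicity with respect to \<open>u\<close>:
  a nonreal zero on a real line in direction \<open>u\<close> rescales to one with imaginary part
  exactly \<open>u\<close>.\<close>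

definition nonvan :: "real^'n \<Rightarrow> bool" where
  "nonvan u \<longleftrightarrow> (\<forall>x. H (ofv x + \<i> *s ofv u) \<noteq> 0)"

lemma nonvan_scaleR: "c > 0 \<Longrightarrow> nonvan (c *\<^sub>R u) \<longleftrightarrow> nonvan u"
proof -
  have *: "nonvan (c *\<^sub>R u)" if "c > 0" "nonvan u" for c u
    unfolding nonvan_def
  proof
    fix x
    have "ofv x + \<i> *s ofv (c *\<^sub>R u) = of_real c *s (ofv (inverse c *\<^sub>R x) + \<i> *s ofv u)"
      using \<open>c > 0\<close> by (simp add: vec_eq_iff algebra_simps)
    then show "H (ofv x + \<i> *s ofv (c *\<^sub>R u)) \<noteq> 0"
      using that by (simp only: homog) (simp add: nonvan_def)
  qed
  show "c > 0 \<Longrightarrow> ?thesis"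
    using *[of c u] *[of "inverse c" "c *\<^sub>R u"] by auto
qed

lemma nonvan_e: "a > 0 \<Longrightarrow> nonvan (a *\<^sub>R e)"
  unfolding nonvan_def
proof
  fix x assume "a > 0"
  have "ofv x + \<i> *s ofv (a *\<^sub>R e) = (\<i> * of_real a) *s ofv e - ofv (- x)"
    by (simp add: vec_eq_iff)
  then show "H (ofv x + \<i> *s ofv (a *\<^sub>R e)) \<noteq> 0"
    using H_line_real[of "\<i> * of_real a" "- x"] \<open>a > 0\<close> by (auto simp: complex_is_Real_iff)
qed

text \<open>The zeros of \<open>s \<mapsto> H (\<sigma> x + \<i> (a e + \<sigma> u) + s v)\<close> start in the lower half plane at
  \<open>\<sigma> = 0\<close> and never meet the real line, hence they are still there at \<open>\<sigma> = 1\<close>.\<close>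

lemma nonvan_add_interior:
  assumes a: "a > 0" and b: "b > 0"
    and u: "\<And>\<sigma>. 0 \<le> \<sigma> \<Longrightarrow> \<sigma> \<le> 1 \<Longrightarrow> nonvan (a *\<^sub>R e + \<sigma> *\<^sub>R u)"
    and v: "\<And>t. h (t *\<^sub>R e - v) = 0 \<Longrightarrow> t > 0"
  shows "nonvan (a *\<^sub>R e + u + b *\<^sub>R v)"
  unfolding nonvan_def
proof
  fix x :: "real^'n"
  define Z where "Z \<sigma> = ofv (\<sigma> *\<^sub>R x) + \<i> *s ofv (a *\<^sub>R e + \<sigma> *\<^sub>R u)" for \<sigma> :: real
  define q where "q p = H (Z (fst p) + snd p *s ofv v)" for p :: "real \<times> complex"
  have hv: "h v \<noteq> 0"
    using v[of 0] real_homog[of "-1" v] by auto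
  have Z_cont: "continuous_on UNIV Z"
    unfolding Z_def by (intro continuous_intros)
  have H_cont: "continuous_on UNIV H" by (rule poly_ext_continuous[OF ext])
  have q_cont: "continuous_on UNIV q"
    unfolding q_def
    by (rule continuous_on_compose2[OF H_cont])
      (auto intro!: continuous_intros continuous_on_compose2[OF Z_cont])
  \<comment> \<open>Degree and leading coefficient are the same for every \<sigma>.\<close>
  have line: "\<exists>p. degree p = d \<and> lead_coeff p = of_real (h v) \<and> (\<forall>s. poly p s = q (\<sigma>, s))" for \<sigma>
  proof -
    obtain p where p: "\<forall>j>d. coeff p j = 0" "coeff p d = H (ofv v)" "\<forall>s. poly p s = q (\<sigma>, s)"
      using poly_ext_homog_line[OF ext homog, of "ofv v" "Z \<sigma>"] unfolding q_def by auto
    then have "degree p = d"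
      using hv by (intro antisym degree_le le_degree) auto
    then show ?thesis using p by auto
  qed
  \<comment> \<open>\<open>H\<close> is nonzero near \<open>ofv v\<close>. A zero with |s| >
    M/\<delta> would put \<open>v\<close> plus \<open>Z \<sigma>\<close> divided by s into this
    neighbourhood, so the zeros are uniformly bounded.\<close>
  have "open {y. H y \<noteq> 0}"
    using H_cont by (intro open_Collect_neq continuous_intros) auto
  then obtain \<delta> where "\<delta> > 0" and ball: "ball (ofv v) \<delta> \<subseteq> {y. H y \<noteq> 0}"
    using hv unfolding open_contains_ball by (metis H_ofv mem_Collect_eq of_real_eq_0_iff)
  then have \<delta>: "\<delta> > 0" "\<And>y. norm (y - ofv v) < \<delta> \<Longrightarrow> H y \<noteq> 0"
    by (auto simp: subset_iff dist_norm norm_minus_commute)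
  have "bounded (Z ` {0..1})"
    by (intro compact_imp_bounded compact_continuous_image continuous_on_subset[OF Z_cont]) auto
  then obtain M where M: "M > 0" "\<And>\<sigma>. 0 \<le> \<sigma> \<Longrightarrow> \<sigma> \<le> 1 \<Longrightarrow> norm (Z \<sigma>) \<le> M"
    unfolding bounded_pos by auto
  have roots_bounded: "norm s \<le> M / \<delta>" if "q (\<sigma>, s) = 0" "0 \<le> \<sigma>" "\<sigma> \<le> 1" for \<sigma> s
  proof (rule ccontr)
    assume s: "\<not> ?thesis"
    moreover have "M / \<delta> > 0" using M \<delta> by simp
    ultimately have "s \<noteq> 0" by auto
    then have *: "Z \<sigma> + s *s ofv v = s *s (ofv v + inverse s *s Z \<sigma>)"
      by (simp add: vec_eq_iff distrib_left)
    have "s ^ d * H (ofv v + inverse s *s Z \<sigma>) = 0"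
      using that(1) unfolding q_def fst_conv snd_conv * homog .
    then have "H (ofv v + inverse s *s Z \<sigma>) = 0"
      using \<open>s \<noteq> 0\<close> by simp
    then have "\<not> norm (inverse s *s Z \<sigma>) < \<delta>"
      using \<delta>(2)[of "ofv v + inverse s *s Z \<sigma>"] by auto
    then have "\<delta> \<le> norm (Z \<sigma>) / norm s"
      by (simp add: norm_smult_vec norm_inverse divide_inverse mult.commute)
    also have "\<dots> \<le> M / norm s"
      using M(2) that by (intro divide_right_mono) auto
    finally show False
      using s \<open>s \<noteq> 0\<close> \<delta> by (simp add: field_simps)
  qed
  \<comment> \<open>\<open>A\<close> holds the parameters with a zero in the closed upper half
    plane, \<open>B\<close> those with a lower bound that excludes zeros in the open one. Both are
    closed, they are disjoint and cover the interval, so connectedness decides \<sigma> = 1 from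
    \<sigma> = 0.\<close>
  define A where "A = {\<sigma>\<in>{0..1}. \<exists>s. Im s \<ge> 0 \<and> q (\<sigma>, s) = 0}"
  define B where "B = {\<sigma>\<in>{0..1}. \<forall>s\<in>{s. Im s > 0}. \<bar>h v\<bar> * Im s ^ d \<le> norm (q (\<sigma>, s))}"
  \<comment> \<open>The bound on zeros makes \<open>A\<close> the projection of a compact
    set.\<close>
  have "A = fst ` (({0..1} \<times> (cball 0 (M / \<delta>) \<inter> {s. Im s \<ge> 0})) \<inter> {p. q p = 0})"
  proof (intro equalityI subsetI)
    fix \<sigma> assume "\<sigma> \<in> A"
    then obtain s where "\<sigma> \<in> {0..1}" "Im s \<ge> 0" "q (\<sigma>, s) = 0" by (auto simp: A_def)
    moreover from this have "norm s \<le> M / \<delta>" using roots_bounded by simp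
    ultimately show "\<sigma> \<in> fst ` (({0..1} \<times> (cball 0 (M / \<delta>) \<inter> {s. Im s \<ge> 0})) \<inter> {p. q p = 0})"
      by (intro image_eqI[of _ _ "(\<sigma>, s)"]) auto
  qed (auto simp: A_def)
  moreover have "closed {s. Im s \<ge> 0}"
    by (intro closed_Collect_le continuous_intros)
  moreover have "closed {p. q p = 0}"
    using q_cont by (intro closed_Collect_eq continuous_intros) auto
  ultimately have "compact A"
    by (auto intro!: compact_continuous_image continuous_intros compact_Int_closed compact_Times)
  then have A_closed: "closed A" by (rule compact_imp_closed)
  have "closed {\<sigma>. \<bar>h v\<bar> * Im s ^ d \<le> norm (q (\<sigma>, s))}" for s
    by (intro closed_Collect_le continuous_intros continuous_on_compose2[OF q_cont]) auto
  then have "closed ({0..1} \<inter> (\<Inter>s\<in>{s. Im s > 0}. {\<sigma>. \<bar>h v\<bar> * Im s ^ d \<le> norm (q (\<sigma>, s))}))"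
    by (intro closed_Int closed_INT) auto
  also have "({0..1} \<inter> (\<Inter>s\<in>{s. Im s > 0}. {\<sigma>. \<bar>h v\<bar> * Im s ^ d \<le> norm (q (\<sigma>, s))})) = B"
    by (auto simp: B_def)
  finally have B_closed: "closed B" .
  have not_A: "\<sigma> \<in> B" if "\<sigma> \<notin> A" "\<sigma> \<in> {0..1}" for \<sigma>
  proof -
    obtain p where p: "degree p = d" "lead_coeff p = of_real (h v)" "\<forall>s. poly p s = q (\<sigma>, s)"
      using line by blast
    have "p \<noteq> 0" using p hv by auto
    moreover have "Im r \<le> 0" if "poly p r = 0" for r
      using that p \<open>\<sigma> \<notin> A\<close> \<open>\<sigma> \<in> {0..1}\<close> unfolding A_def by (metis (mono_tags, lifting) linear mem_Collect_eq)
    ultimately show ?thesis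
      using norm_poly_ge_Im_power[of p] p that unfolding B_def by auto
  qed
  \<comment> \<open>A zero for a common parameter must be real; a real multiple of \<open>v\<close>
    changes only the real part, so assumption \<open>u\<close> is contradicted.\<close>
  have disjoint: "\<sigma> \<notin> B" if mem: "\<sigma> \<in> A" for \<sigma>
  proof
    assume "\<sigma> \<in> B"
    obtain s where s: "Im s \<ge> 0" "q (\<sigma>, s) = 0" "\<sigma> \<in> {0..1}" using mem by (auto simp: A_def)
    then have "Im s = 0" 
      using \<open>\<sigma> \<in> B\<close> hv unfolding B_def
      by (smt (verit, best) mem_Collect_eq mult_pos_pos norm_zero zero_less_power)
    then have "Z \<sigma> + s *s ofv v = ofv (\<sigma> *\<^sub>R x + Re s *\<^sub>R v) + \<i> *s ofv (a *\<^sub>R e + \<sigma> *\<^sub>R u)"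
      by (simp add: Z_def vec_eq_iff complex_eq_iff)
    then show False
      using u[of \<sigma>] s unfolding nonvan_def q_def by auto
  qed
  have "0 \<notin> A"
  proof
    assume "0 \<in> A"
    then obtain s where s: "Im s \<ge> 0" "H (\<i> *s ofv (a *\<^sub>R e) + s *s ofv v) = 0"
      by (auto simp: A_def q_def Z_def)
    have "s \<noteq> 0"
    proof
      assume "s = 0"
      then show False using s nonvan_e[OF a] unfolding nonvan_def by (auto dest: spec[of _ 0])
    qed
    \<comment> \<open>Factoring out \<open>- s\<close> turns the zero into a root t of h(t e - v).
      It is real, hence positive by assumption \<open>v\<close>, which puts s = -i a/t in the lower
      half plane.\<close>
    define t where "t = - \<i> * of_real a / s"
    have "\<i> *s ofv (a *\<^sub>R e) + s *s ofv v = (- s) *s (t *s ofv e - ofv v)"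
      using \<open>s \<noteq> 0\<close> by (simp add: vec_eq_iff t_def field_simps)
    then have Ht: "H (t *s ofv e - ofv v) = 0"
      using s \<open>s \<noteq> 0\<close> by (simp only: homog) simp
    then obtain r where r: "t = of_real r"
      using H_line_real by (meson Reals_cases)
    have "H (ofv (r *\<^sub>R e - v)) = 0"
      using Ht by (simp add: r ofv_diff ofv_scaleR)
    then have "r > 0" using v by simp
    have "s = - \<i> * of_real (a / r)"
      using r \<open>s \<noteq> 0\<close> \<open>r > 0\<close> by (simp add: t_def field_simps)
    then have "Im s < 0" using \<open>r > 0\<close> a by simp
    with s show False by simp
  qed
  have "1 \<in> B"
  proof (rule ccontr)
    assume "1 \<notin> B"
    then have "1 \<in> A" using not_A[of 1] by auto
    moreover have "0 \<in> B" using not_A[of 0] \<open>0 \<notin> A\<close> by auto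
    moreover have "connected {0..1::real}" by simp
    ultimately show False
      unfolding connected_closed using A_closed B_closed not_A disjoint
      by (metis (no_types, lifting) UnCI disjoint_iff IntD1 IntD2 IntI atLeastAtMost_iff empty_iff order_refl subsetI zero_le_one)
  qed
  then have "\<And>s. Im s > 0 \<Longrightarrow> \<bar>h v\<bar> * Im s ^ d \<le> norm (q (1, s))"
    by (simp add: B_def)
  from this[of "\<i> * of_real b"] have "\<bar>h v\<bar> * b ^ d \<le> norm (q (1, \<i> * of_real b))"
    using b by simp
  then have "q (1, \<i> * of_real b) \<noteq> 0"
    using hv b by (smt (verit, best) mult_pos_pos norm_zero zero_less_power)
  moreover have "Z 1 + (\<i> * of_real b) *s ofv v = ofv x + \<i> *s ofv (a *\<^sub>R e + u + b *\<^sub>R v)"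
    by (simp add: Z_def vec_eq_iff algebra_simps)
  ultimately show "H (ofv x + \<i> *s ofv (a *\<^sub>R e + u + b *\<^sub>R v)) \<noteq> 0"
    by (simp add: q_def)
qed

text \<open>Admitting vectors of \<open>hyp_cone h e\<close> one at a time (\<open>adm_add\<close> below) replaces
  Garding's theorem that this cone is convex.\<close>

definition adm :: "(real^'n) set" where
  "adm = {u. \<forall>a>0. \<forall>\<tau>\<ge>0. nonvan (a *\<^sub>R e + \<tau> *\<^sub>R u)}"

lemma adm_0: "0 \<in> adm"
  by (simp add: adm_def nonvan_e)

lemma adm_nonvan: "u \<in> adm \<Longrightarrow> a > 0 \<Longrightarrow> nonvan (a *\<^sub>R e + u)"
  unfolding adm_def by (metis (mono_tags, lifting) mem_Collect_eq scaleR_one zero_le_one)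

lemma adm_add:
  assumes u: "u \<in> adm" and v: "v \<in> hyp_cone h e" and "b \<ge> 0"
  shows "u + b *\<^sub>R v \<in> adm"
proof (cases "b = 0")
  case False
  have "nonvan (a *\<^sub>R e + \<tau> *\<^sub>R (u + b *\<^sub>R v))" if a: "a > 0" and \<tau>: "\<tau> > 0" for a \<tau>
  proof -
    have b\<tau>: "b * \<tau> > 0" using False \<open>b \<ge> 0\<close> \<tau> by simp
    \<comment> \<open>Cone vectors only have nonnegative eigenvalues; adding \<epsilon> e makes them
      positive. This choice gives \<open>(b * \<tau>) * \<epsilon>\<close> the value
      \<open>a / 2\<close>, the half of \<open>a\<close> held back.\<close>
    define \<epsilon> where "\<epsilon> = a / (2 * (b * \<tau>))"
    have "\<epsilon> > 0" using a b\<tau> by (simp add: \<epsilon>_def)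
    have "nonvan ((a / 2) *\<^sub>R e + \<tau> *\<^sub>R u + (b * \<tau>) *\<^sub>R (v + \<epsilon> *\<^sub>R e))"
    proof (rule nonvan_add_interior[OF _ b\<tau>])
      show "a / 2 > 0" using a by simp
      show "nonvan ((a / 2) *\<^sub>R e + \<sigma> *\<^sub>R (\<tau> *\<^sub>R u))" if "0 \<le> \<sigma>" for \<sigma>
        using u a \<tau> that by (auto simp: adm_def)
      show "t > 0" if "h (t *\<^sub>R e - (v + \<epsilon> *\<^sub>R e)) = 0" for t
      proof -
        have "h ((t - \<epsilon>) *\<^sub>R e - v) = 0" using that by (simp add: algebra_simps)
        then show ?thesis using hyp_coneD[OF v] \<open>\<epsilon> > 0\<close> by fastforce
      qed
    qed
    moreover have "(a / 2) *\<^sub>R e + \<tau> *\<^sub>R u + (b * \<tau>) *\<^sub>R (v + \<epsilon> *\<^sub>R e) = a *\<^sub>R e + \<tau> *\<^sub>R (u + b *\<^sub>R v)"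
      using b\<tau> False \<tau> by (simp add: \<epsilon>_def vec_eq_iff field_simps)
    ultimately show ?thesis by simp
  qed
  then show ?thesis
    using nonvan_e unfolding adm_def by (auto simp: le_less)
qed (use u in simp)

text \<open>For a distribution \<open>p\<close> on \<open>A\<close> the added vector is a multiple
  of the mean; in this way means satisfy the hypothesis of \<open>hbr_tube_stable\<close>.\<close>

lemma adm_add_sum:
  assumes "finite A" "A \<subseteq> hyp_cone h e" "\<And>a. a \<in> A \<Longrightarrow> p a \<ge> 0" "u \<in> adm" "b \<ge> 0"
  shows "u + b *\<^sub>R (\<Sum>a\<in>A. p a *\<^sub>R a) \<in> adm"
  using assms(1-3)
proof (induction A)
  case (insert a A)
  have "u + b *\<^sub>R (\<Sum>a\<in>insert a A. p a *\<^sub>R a) = (u + b *\<^sub>R (\<Sum>a\<in>A. p a *\<^sub>R a)) + (b * p a) *\<^sub>R a"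
    using insert by (simp add: algebra_simps)
  moreover have "\<dots> \<in> adm"
  proof (rule adm_add)
    show "u + b *\<^sub>R (\<Sum>a\<in>A. p a *\<^sub>R a) \<in> adm" using insert by simp
  qed (use insert \<open>b \<ge> 0\<close> in auto)
  ultimately show ?case by metis
qed (use assms in simp)

section \<open>Stability of the mixed polynomials\<close>

lemma hyp_coneI:
  assumes "\<And>t. h (t *\<^sub>R e - v) = 0 \<Longrightarrow> t \<ge> 0"
  shows "v \<in> hyp_cone h e"
  using assms char_poly_nonzero[of v] poly_char_poly[of v]
  by (auto simp: hyp_cone_def eigenvalues_def)

text \<open>At the purely imaginary point, H(i u) = i^d h(u).\<close>

lemma nonvan_nonzero:
  assumes "nonvan u"
  shows "h u \<noteq> 0"
proof -
  have "H (ofv 0 + \<i> *s ofv u) \<noteq> 0" using assms unfolding nonvan_def by blast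
  then show ?thesis using homog[of \<i> "ofv u"] by auto
qed

text \<open>The analogue of upper half plane stability, with a cone of imaginary parts. The summand
  with a > 0 keeps these where \<open>adm\<close> guarantees non-vanishing of
  \<open>H\<close>.\<close>

definition tube_stable :: "(complex^'n \<Rightarrow> complex) \<Rightarrow> bool" where
  "tube_stable F \<longleftrightarrow> (\<forall>x. \<forall>u\<in>adm. \<forall>a>0. F (ofv x + \<i> *s ofv (a *\<^sub>R e + u)) \<noteq> 0)"

lemma tube_stable_H: "tube_stable H"
  using adm_nonvan by (auto simp: tube_stable_def nonvan_def)

text \<open>Along z + s v with Im s >= 0 the imaginary part is still a multiple of \<open>e\<close>
  plus an admissible vector, so the restriction has no zero in the closed upper half plane and
  \<open>poly_minus_deriv_nonzero\<close> applies. The condition on \<open>v\<close> is phrased as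
  absorption by \<open>adm\<close> to admit means of cone vectors.\<close>

lemma tube_stable_dir_D:
  assumes F: "poly_ext k f F" "tube_stable F"
    and v: "\<And>u b. u \<in> adm \<Longrightarrow> b \<ge> 0 \<Longrightarrow> u + b *\<^sub>R v \<in> adm"
  shows "\<exists>G. poly_ext k (\<lambda>x. f x - y * dir_D v f x) G \<and> tube_stable G"
proof -
  obtain G where G: "poly_ext (k - 1) (dir_D v f) G"
    and dG: "\<And>z. ((\<lambda>s. F (z + s *s ofv v)) has_field_derivative G z) (at 0)"
    using poly_ext_dir_D[OF F(1)] by blast
  have "poly_ext k (dir_D v f) G"
    using G poly_ext.weaken[OF G] by (cases k) auto
  from poly_ext.add[OF F(1) poly_ext_cmult[OF this, of "- y"]]
  have "poly_ext k (\<lambda>x. f x - y * dir_D v f x) (\<lambda>z. F z - of_real y * G z)"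
    by simp
  moreover have "tube_stable (\<lambda>z. F z - of_real y * G z)"
    unfolding tube_stable_def
  proof (intro allI ballI impI)
    fix x u and a :: real assume u: "u \<in> adm" "a > 0"
    define z where "z = ofv x + \<i> *s ofv (a *\<^sub>R e + u)"
    obtain p where p: "\<And>s. poly p s = F (z + s *s ofv v)"
      using poly_ext_complex_line[OF F(1)] by metis
    have "poly p s \<noteq> 0" if "Im s \<ge> 0" for s
    proof -
      have "z + s *s ofv v = ofv (x + Re s *\<^sub>R v) + \<i> *s ofv (a *\<^sub>R e + (u + Im s *\<^sub>R v))"
        by (simp add: z_def vec_eq_iff complex_eq_iff algebra_simps)
      then show ?thesis
        using F(2) v[OF u(1) that] u(2) unfolding p tube_stable_def by metis
    qed
    then have "poly p 0 - of_real y * poly (pderiv p) 0 \<noteq> 0"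
      by (rule poly_minus_deriv_nonzero)
    moreover have "((\<lambda>s. F (z + s *s ofv v)) has_field_derivative poly (pderiv p) 0) (at 0)"
      using poly_DERIV[of p 0] by (simp add: p[abs_def])
    then have "poly (pderiv p) 0 = G z"
      using dG DERIV_unique by blast
    ultimately show "F (ofv x + \<i> *s ofv (a *\<^sub>R e + u))
        - of_real y * G (ofv x + \<i> *s ofv (a *\<^sub>R e + u)) \<noteq> 0"
      by (simp add: p z_def)
  qed
  ultimately show ?thesis by blast
qed

lemma hbr_tube_stable:
  assumes "\<And>j u b. j < k \<Longrightarrow> u \<in> adm \<Longrightarrow> b \<ge> 0 \<Longrightarrow> u + b *\<^sub>R U j \<in> adm"
  shows "\<exists>F. poly_ext (Suc d) (hbr h U k y) F \<and> tube_stable F"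
  using assms
proof (induction k)
  case 0
  show ?case using ext tube_stable_H by auto
next
  case (Suc k)
  then obtain F where "poly_ext (Suc d) (hbr h U k y) F" "tube_stable F" by auto
  from tube_stable_dir_D[OF this Suc.prems] show ?case by simp
qed

text \<open>Each derivative lowers the degree, so the correction terms stay below degree
  \<open>d\<close>.\<close>

lemma hbr_leading:
  "\<exists>r R. poly_ext d r R \<and> hbr h V k y = (\<lambda>x. h x + r x)"
proof (induction k)
  case 0
  show ?case using poly_ext_zero[of d] by (auto intro!: exI[of _ "\<lambda>_. 0"])
next
  case (Suc k)
  then obtain r R where r: "poly_ext d r R" "hbr h V k y = (\<lambda>x. h x + r x)" by blast
  have "poly_ext (Suc d) (hbr h V k y) (\<lambda>z. H z + R z)"
    unfolding r(2) using r(1) by (intro poly_ext.add ext poly_ext.weaken)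
  then obtain G where "poly_ext d (dir_D (V k) (hbr h V k y)) G"
    using poly_ext_dir_D by fastforce
  from poly_ext.add[OF r(1) poly_ext_cmult[OF this, of "- y k"]]
  have "poly_ext d (\<lambda>x. r x - y k * dir_D (V k) (hbr h V k y) x) (\<lambda>z. R z - of_real (y k) * G z)"
    by simp
  moreover have "hbr h V (Suc k) y = (\<lambda>x. h x + (r x - y k * dir_D (V k) (hbr h V k y) x))"
    using r(2) by (simp add: fun_eq_iff)
  ultimately show ?case by blast
qed

lemma hbr_poly_ext: "\<exists>F. poly_ext (Suc d) (hbr h V k y) F"
  using hbr_leading ext poly_ext.add poly_ext.weaken by metis

text \<open>The top coefficient comes from \<open>h\<close> alone and does not vary with
  \<open>V\<close>; this gives the common degree and sign in a compatible family.\<close>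

lemma hbr_line:
  assumes P: "\<And>t. poly P t = hbr h V k y (t *\<^sub>R e + w)"
  shows "degree P = d" "lead_coeff P = h e"
proof -
  obtain r R where r: "poly_ext d r R" "hbr h V k y = (\<lambda>x. h x + r x)"
    using hbr_leading by blast
  obtain p where p: "\<forall>j>d. coeff p j = 0" "coeff p d = h e" "\<forall>s. poly p s = h (w + s *\<^sub>R e)"
    using real_line by metis
  obtain q where q: "\<forall>j\<ge>d. coeff q j = 0" "\<forall>s. poly q s = r (w + s *\<^sub>R e)"
    using poly_ext_real_line[OF r(1)] by metis
  have "P = p + q"
    using P p q r by (simp add: poly_eq_poly_eq_iff[symmetric] fun_eq_iff add.commute)
  then have *: "\<forall>j>d. coeff P j = 0" "coeff P d = h e"
    using p q by auto
  then show "degree P = d"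
    using h_e by (intro antisym degree_le le_degree) auto
  with * show "lead_coeff P = h e" by simp
qed

text \<open>Stability with the admissible vector 0 excludes roots in the open upper half plane, and
  conjugation excludes those in the lower one.\<close>

lemma real_rooted_hbr:
  assumes U: "\<And>j u b. j < k \<Longrightarrow> u \<in> adm \<Longrightarrow> b \<ge> 0 \<Longrightarrow> u + b *\<^sub>R U j \<in> adm"
    and P: "\<And>t. poly P t = hbr h U k y (t *\<^sub>R e + w)"
  shows "real_rooted P"
proof -
  obtain F where F: "poly_ext (Suc d) (hbr h U k y) F" "tube_stable F"
    using hbr_tube_stable[of k U y] U by blast
  obtain p where p: "\<forall>s. poly p s = hbr h U k y (w + s *\<^sub>R e)"
     "\<And>s. poly (map_poly complex_of_real p) s = F (ofv w + s *s ofv e)"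
    using poly_ext_real_line[OF F(1)] by metis
  have "p = P"
    using p P by (simp add: poly_eq_poly_eq_iff[symmetric] fun_eq_iff add.commute)
  have upper: "poly (map_poly complex_of_real P) z \<noteq> 0" if "Im z > 0" for z
  proof -
    have "ofv w + z *s ofv e = ofv (w + Re z *\<^sub>R e) + \<i> *s ofv (Im z *\<^sub>R e + 0)"
      by (simp add: vec_eq_iff complex_eq_iff algebra_simps)
    then show ?thesis
      using F(2) that adm_0 p(2) unfolding \<open>p = P\<close> tube_stable_def by metis
  qed
  show ?thesis
    unfolding real_rooted_def
  proof (intro disjI2 allI impI)
    fix z assume z: "poly (map_poly complex_of_real P) z = 0"
    then have "poly (map_poly complex_of_real P) (cnj z) = 0"
      by (simp add: poly_map_of_real_cnj)
    then have "Im z = 0" using z upper[of z] upper[of "cnj z"] by fastforce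
    then show "z \<in> \<real>" by (simp add: complex_is_Real_iff)
  qed
qed

section \<open>Expectation over independent choices\<close>

lemma hbr_cong: "(\<And>j. j < k \<Longrightarrow> V j = W j) \<Longrightarrow> hbr h V k y = hbr h W k y"
  by (induction k) auto

text \<open>The last factor is affine in its vector and the weights sum to 1, so averaging replaces
  that vector by its mean. Averaging over the earlier vectors passes through the last factor by
  linearity of \<open>dir_D\<close> in the function.\<close>

lemma hbr_expectation:
  assumes "\<And>j. j < k \<Longrightarrow> finite (VS j)" "\<And>j. j < k \<Longrightarrow> (\<Sum>a\<in>VS j. p j a) = 1"
  shows "(\<Sum>s\<in>PiE {..<k} VS. (\<Prod>j<k. p j (s j)) * hbr h s k y x)
    = hbr h (\<lambda>j. \<Sum>a\<in>VS j. p j a *\<^sub>R a) k y x"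
  using assms
proof (induction k arbitrary: x)
  case 0
  show ?case by simp
next
  case (Suc k)
  let ?U = "\<lambda>j. \<Sum>a\<in>VS j. p j a *\<^sub>R a"
  let ?w = "\<lambda>s. \<Prod>j<k. p j (s j)"
  let ?P = "PiE {..<k} VS"
  have IH: "(\<Sum>s\<in>?P. ?w s * hbr h s k y x) = hbr h ?U k y x" for x
    using Suc by simp
  have fin: "finite ?P" using Suc.prems by (intro finite_PiE) auto
  have cong: "hbr h (s(k := a)) k y = hbr h s k y" for s a
    by (rule hbr_cong) auto
  \<comment> \<open>A longer tuple is a shorter one with \<open>a\<close> put at position
    \<open>k\<close>; the first \<open>k\<close> factors ignore that position.\<close>
  have Pi: "PiE {..<Suc k} VS = (\<lambda>(a, s). s(k := a)) ` (VS k \<times> ?P)"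
    by (simp add: lessThan_Suc PiE_insert_eq)
  have "inj_on (\<lambda>(a, s). s(k := a)) (VS k \<times> ?P)"
    by (rule inj_combinator) simp
  then have "(\<Sum>s\<in>PiE {..<Suc k} VS. (\<Prod>j<Suc k. p j (s j)) * hbr h s (Suc k) y x)
      = (\<Sum>(a, s)\<in>VS k \<times> ?P. p k a * ?w s * (hbr h s k y x - y k * dir_D a (hbr h s k y) x))"
    unfolding Pi by (subst sum.reindex)
      (auto intro!: sum.cong simp: cong case_prod_unfold mult.commute)
  also have "\<dots> = (\<Sum>s\<in>?P. \<Sum>a\<in>VS k. p k a * ?w s * (hbr h s k y x - y k * dir_D a (hbr h s k y) x))"
    unfolding sum.cartesian_product[symmetric] by (rule sum.swap)
  also have "\<dots> = (\<Sum>s\<in>?P. ?w s * hbr h s k y x - y k * (?w s * dir_D (?U k) (hbr h s k y) x))"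
  proof (rule sum.cong)
    fix s
    have "(\<Sum>a\<in>VS k. p k a * ?w s * (hbr h s k y x - y k * dir_D a (hbr h s k y) x))
      = (\<Sum>a\<in>VS k. p k a) * (?w s * hbr h s k y x)
        - y k * (?w s * (\<Sum>a\<in>VS k. p k a * dir_D a (hbr h s k y) x))"
      by (simp add: sum_distrib_left sum_distrib_right sum_subtractf[symmetric] algebra_simps)
    then show "(\<Sum>a\<in>VS k. p k a * ?w s * (hbr h s k y x - y k * dir_D a (hbr h s k y) x))
      = ?w s * hbr h s k y x - y k * (?w s * dir_D (?U k) (hbr h s k y) x)"
      using Suc.prems(2)[of k] by (simp add: dir_D_scaleR_sum)
  qed simp
  also have "\<dots> = hbr h ?U k y x - y k * (\<Sum>s\<in>?P. ?w s * dir_D (?U k) (hbr h s k y) x)"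
    by (simp add: sum_subtractf sum_distrib_left IH)
  also have "(\<Sum>s\<in>?P. ?w s * dir_D (?U k) (hbr h s k y) x)
      = dir_D (?U k) (\<lambda>x. \<Sum>s\<in>?P. ?w s * hbr h s k y x) x"
    using fin hbr_poly_ext poly_ext_differentiable by (intro dir_D_sum[symmetric]) blast+
  also have "(\<lambda>x. \<Sum>s\<in>?P. ?w s * hbr h s k y x) = hbr h ?U k y"
    using IH by auto
  finally show ?case by simp
qed

section \<open>Directions of rank at most one\<close>

text \<open>The characteristic polynomial is c t^n times at most one factor t - l, and h(e + s v) is
  (-s)^d times its value at -1/s, that is c or c (1 + s l).\<close>

lemma rank_one_affine_at_e:
  assumes "hyp_rank h e v \<le> 1"
  shows "\<exists>a b. \<forall>s>0. h (e + s *\<^sub>R v) = a + s * b"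
proof -
  define A where "A = filter_mset (\<lambda>l. l \<noteq> 0) (proots (char_poly h e v))"
  define n where "n = count (proots (char_poly h e v)) 0"
  have A: "size A \<le> 1" using assms by (simp add: A_def hyp_rank_def eigenvalues_def)
  have split: "proots (char_poly h e v) = replicate_mset n 0 + A"
    unfolding A_def n_def
    by (metis (full_types) filter_eq_replicate_mset multiset_partition)
  obtain c where c: "char_poly h e v = smult c (\<Prod>l\<in>#proots (char_poly h e v). [:- l, 1:])"
    using real_rooted_split[OF char_poly_nonzero real_rooted_char_poly] by blast
  have "degree (char_poly h e v) = size (proots (char_poly h e v))"
  proof -
    have "degree (\<Prod>l\<in>#M. [:- l, 1:]) = size M" for M :: "real multiset"
    proof (induction M)
      case (add x M)
      have "(\<Prod>l\<in>#M. [:- l, 1:]) \<noteq> 0" by auto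
      then have "degree ([:- x, 1:] * (\<Prod>l\<in>#M. [:- l, 1:])) = Suc (size M)"
        using add.IH by (subst degree_mult_eq) auto
      then show ?case by (simp only: image_mset_add_mset prod_mset.add_mset size_add_mset)
    qed simp
    then show ?thesis using c char_poly_nonzero[of v] by (metis degree_smult_eq smult_eq_0_iff)
  qed
  then have d: "n + size A = d" using degree_char_poly[of v] split by simp
  have p: "poly (char_poly h e v) t = c * t ^ n * (\<Prod>l\<in>#A. t - l)" for t
    by (subst c) (simp add: split poly_prod_mset image_mset.compositionality o_def)
  have *: "h (e + s *\<^sub>R v) = (- s) ^ d * (c * (- 1 / s) ^ n * (\<Prod>l\<in>#A. - 1 / s - l))" if "s > 0" for s
  proof -
    have "e + s *\<^sub>R v = (- s) *\<^sub>R ((- 1 / s) *\<^sub>R e - v)"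
      using that by (simp add: vec_eq_iff field_simps)
    then show ?thesis
      by (simp only: real_homog p[symmetric] poly_char_poly)
  qed
  have **: "(- s) ^ n * (- 1 / s) ^ n = 1" if "s > 0" for s :: real
    using that by (simp flip: power_mult_distrib)
  show ?thesis
  proof (cases "A = {#}")
    case True
    have "h (e + s *\<^sub>R v) = c + s * 0" if "s > 0" for s
      using *[OF that] **[OF that] True d by (simp add: mult_ac)
    then show ?thesis by blast
  next
    case False
    then obtain l where "A = {#l#}"
      using A by (metis One_nat_def le_Suc_eq le_zero_eq size_1_singleton_mset size_eq_0_iff_empty)
    have "h (e + s *\<^sub>R v) = c + s * (c * l)" if "s > 0" for s
    proof -
      have "h (e + s *\<^sub>R v) = c * ((- s) ^ n * (- 1 / s) ^ n) * (- s * (- 1 / s - l))"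
        using *[OF that] \<open>A = {#l#}\<close> d[symmetric] by (simp add: mult_ac)
      also have "\<dots> = c + s * (c * l)"
        unfolding **[OF that] using that by (simp add: field_simps)
      finally show ?thesis .
    qed
    then show ?thesis by blast
  qed
qed

text \<open>Adding T e shifts all eigenvalues by T, so a bound T on the moduli of the finitely many
  eigenvalues of \<open>x\<close> and \<open>- x\<close> suffices.\<close>

lemma cone_absorbing: "\<exists>T>0. T *\<^sub>R e + x \<in> hyp_cone h e \<and> T *\<^sub>R e - x \<in> hyp_cone h e"
proof -
  define S where "S = {t. poly (char_poly h e x) t = 0} \<union> {t. poly (char_poly h e (- x)) t = 0}"
  have "finite S"
    unfolding S_def using char_poly_nonzero by (intro finite_UnI poly_roots_finite)
  then obtain T where T: "T > 0" "\<And>t. t \<in> S \<Longrightarrow> \<bar>t\<bar> \<le> T"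
    using finite_imp_bounded[of S] unfolding bounded_pos by auto
  have *: "t \<ge> 0" if "h (t *\<^sub>R e - (T *\<^sub>R e + z)) = 0" "z = x \<or> z = - x" for t z
  proof -
    have "h ((t - T) *\<^sub>R e - z) = 0" using that(1) by (simp add: algebra_simps)
    then have "t - T \<in> S" using that(2) by (auto simp: S_def poly_char_poly)
    then show ?thesis using T(2)[of "t - T"] by auto
  qed
  have "T *\<^sub>R e + x \<in> hyp_cone h e" "T *\<^sub>R e + (- x) \<in> hyp_cone h e"
    using * by (auto intro!: hyp_coneI simp del: add_uminus_conv_diff)
  then show ?thesis using T(1) by auto
qed

text \<open>Eigenvalues of \<open>x\<close> relative to \<open>e + s v\<close> are bounded uniformly in \<open>s \<ge> 0\<close>, so
  \<open>h (e + s v + x)\<close> grows at most as fast as \<open>h (e + s v)\<close>.\<close>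

lemma cone_growth:
  assumes v: "v \<in> hyp_cone h e"
  shows "\<exists>K. \<forall>s\<ge>0. \<bar>h (e + s *\<^sub>R v + x)\<bar> \<le> K * \<bar>h (e + s *\<^sub>R v)\<bar>"
proof -
  obtain T where T: "T > 0" "T *\<^sub>R e + x \<in> hyp_cone h e" "T *\<^sub>R e - x \<in> hyp_cone h e"
    using cone_absorbing by blast
  have "\<bar>h (e + s *\<^sub>R v + x)\<bar> \<le> (1 + T) ^ d * \<bar>h (e + s *\<^sub>R v)\<bar>" if s: "s \<ge> 0" for s
  proof -
    let ?u = "e + s *\<^sub>R v"
    obtain p where p: "\<forall>j>d. coeff p j = 0" "\<And>t. poly p t = H (ofv ?u + t *s ofv x)"
      using poly_ext_homog_line[OF ext homog] by metis
    have sv: "s *\<^sub>R v \<in> adm" using adm_add[OF adm_0 v s] by simp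
    have nv: "nonvan ?u" using adm_nonvan[OF sv, of 1] by simp
    have "poly p 0 \<noteq> 0" using nonvan_nonzero[OF nv] p(2)[of 0] by simp
    have roots: "T * norm r \<ge> 1" if "poly p r = 0" for r
    proof (rule ccontr)
      assume small: "\<not> T * norm r \<ge> 1"
      have "r \<noteq> 0" using that \<open>poly p 0 \<noteq> 0\<close> by auto
      have "Im r = 0"
      proof (rule ccontr)
        assume "Im r \<noteq> 0"
        \<comment> \<open>With w = c/r, the point w (u + r x) equals w u + c x, where u stands for
          \<open>?u\<close>; its imaginary part is Im w times u. The sign c makes Im w positive, so
          \<open>nonvan\<close> excludes nonreal roots.\<close>
        define q where "q = inverse r"
        define c where "c = sgn (Im q)"
        define w where "w = of_real c * q"
        have "Im q \<noteq> 0"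
          using \<open>Im r \<noteq> 0\<close> \<open>r \<noteq> 0\<close> by (simp add: q_def complex_eq_iff sum_power2_eq_zero_iff)
        then have "Im w > 0" by (simp add: w_def c_def sgn_if)
        have "ofv (Re w *\<^sub>R ?u + c *\<^sub>R x) + \<i> *s ofv (Im w *\<^sub>R ?u) = w *s ofv ?u + of_real c *s ofv x"
          by (simp add: vec_eq_iff complex_eq_iff algebra_simps)
        also have "\<dots> = w *s (ofv ?u + r *s ofv x)"
          using \<open>r \<noteq> 0\<close> by (simp add: w_def q_def vec_eq_iff field_simps)
        finally have "H (ofv (Re w *\<^sub>R ?u + c *\<^sub>R x) + \<i> *s ofv (Im w *\<^sub>R ?u)) = w ^ d * poly p r"
          by (simp only: homog p(2))
        moreover have "nonvan (Im w *\<^sub>R ?u)"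
          using nv nonvan_scaleR[OF \<open>Im w > 0\<close>] by blast
        ultimately show False using that unfolding nonvan_def by simp
      qed
      then have r: "r = of_real (Re r)" by (simp add: complex_eq_iff)
      define \<rho> where "\<rho> = Re r"
      \<comment> \<open>If T |\<rho>| < 1, then \<open>?u + \<rho> *\<^sub>R x\<close> is a positive
        multiple of \<open>e\<close> plus an admissible vector; the sign of \<rho> selects the cone
        vector.\<close>
      define x' where "x' = (if \<rho> \<ge> 0 then T *\<^sub>R e + x else T *\<^sub>R e - x)"
      have "T * \<bar>\<rho>\<bar> < 1" using small r unfolding \<rho>_def by (metis norm_of_real not_le)
      then have "nonvan ((1 - T * \<bar>\<rho>\<bar>) *\<^sub>R e + (s *\<^sub>R v + \<bar>\<rho>\<bar> *\<^sub>R x'))"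
        using T by (intro adm_nonvan adm_add sv) (auto simp: x'_def)
      moreover have "(1 - T * \<bar>\<rho>\<bar>) *\<^sub>R e + (s *\<^sub>R v + \<bar>\<rho>\<bar> *\<^sub>R x') = ?u + \<rho> *\<^sub>R x"
        by (auto simp: x'_def algebra_simps)
      ultimately have "h (?u + \<rho> *\<^sub>R x) \<noteq> 0" using nonvan_nonzero by simp
      moreover have "poly p r = H (ofv (?u + \<rho> *\<^sub>R x))"
        unfolding p(2) ofv_add[of ?u] ofv_scaleR[of \<rho>] using r by (simp add: \<rho>_def)
      ultimately show False using that by simp
    qed
    have "p \<noteq> 0" using \<open>poly p 0 \<noteq> 0\<close> by auto
    have "degree p \<le> d" using p by (intro degree_le) auto
    \<comment> \<open>The arguments 1 and 0 give \<open>h\<close> at \<open>?u + x\<close> and at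
      \<open>?u\<close>; the constant is independent of s.\<close>
    have "norm (poly p 1) \<le> norm (poly p 0) * (1 + T) ^ degree p"
      using norm_poly_le_of_roots_away[OF \<open>p \<noteq> 0\<close> T(1) roots, of 1] by simp
    also have "\<dots> \<le> norm (poly p 0) * (1 + T) ^ d"
      using \<open>degree p \<le> d\<close> T by (intro mult_left_mono power_increasing) auto
    finally show ?thesis
      unfolding p(2) by (simp add: ofv_add[symmetric] mult.commute del: ofv_nth)
  qed
  then show ?thesis by blast
qed

text \<open>Growth along the ray from \<open>e\<close> is linear. \<open>cone_growth\<close> carries
  this to the ray from x = e + (x - e), and linear growth forces degree at most one.\<close>

lemma rank_one_affine:
  assumes v: "v \<in> hyp_cone h e" "hyp_rank h e v \<le> 1"
  shows "h (x + s *\<^sub>R v) = h x + s * (h (x + v) - h x)"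
proof -
  obtain a b where ab: "\<And>s. s > 0 \<Longrightarrow> h (e + s *\<^sub>R v) = a + s * b"
    using rank_one_affine_at_e[OF v(2)] by blast
  obtain K where K: "\<And>s. s \<ge> 0 \<Longrightarrow> \<bar>h (e + s *\<^sub>R v + (x - e))\<bar> \<le> K * \<bar>h (e + s *\<^sub>R v)\<bar>"
    using cone_growth[OF v(1)] by blast
  obtain p where p: "\<And>s. poly p s = h (x + s *\<^sub>R v)"
    using real_line by metis
  have "\<bar>poly p s\<bar> \<le> (\<bar>K\<bar> * (\<bar>a\<bar> + \<bar>b\<bar>)) * (1 + s)" if "s > 0" for s
  proof -
    have "\<bar>poly p s\<bar> = \<bar>h (e + s *\<^sub>R v + (x - e))\<bar>" by (simp add: p algebra_simps)
    also have "\<dots> \<le> K * \<bar>a + s * b\<bar>" using K[of s] ab[of s] that by simp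
    also have "\<dots> \<le> \<bar>K\<bar> * ((\<bar>a\<bar> + \<bar>b\<bar>) * (1 + s))"
    proof (rule mult_mono)
      have "\<bar>a + s * b\<bar> \<le> \<bar>a\<bar> + s * \<bar>b\<bar>"
        using that abs_triangle_ineq[of a "s * b"] by (simp add: abs_mult)
      also have "\<dots> \<le> (\<bar>a\<bar> + \<bar>b\<bar>) * (1 + s)" using that by (simp add: algebra_simps)
      finally show "\<bar>a + s * b\<bar> \<le> (\<bar>a\<bar> + \<bar>b\<bar>) * (1 + s)" .
    qed auto
    finally show ?thesis by (simp add: mult.assoc)
  qed
  then have "degree p \<le> 1" by (rule degree_le_1_of_linear_growth)
  then obtain \<alpha> \<beta> where "p = [:\<alpha>, \<beta>:]"
    by (metis One_nat_def degree_pCons_eq_if le_Suc_eq le_zero_eq degree_eq_zeroE nat.inject pCons_cases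
      pCons_0_0)
  then have *: "h (x + s *\<^sub>R v) = \<alpha> + s * \<beta>" for s using p[of s] by simp
  show ?thesis using *[of 0] *[of 1] *[of s] by simp
qed

text \<open>By induction the earlier factors are a translation, which commutes with
  \<open>dir_D\<close>; affineness makes the derivative a difference h(x + v) - h(x).\<close>

lemma hbr_rank_one:
  assumes "\<And>j. j < k \<Longrightarrow> V j \<in> hyp_cone h e" "\<And>j. j < k \<Longrightarrow> hyp_rank h e (V j) \<le> 1"
  shows "hbr h V k \<alpha> = (\<lambda>x. h (x - (\<Sum>j<k. \<alpha> j *\<^sub>R V j)))"
  using assms
proof (induction k)
  case (Suc k)
  let ?c = "\<Sum>j<k. \<alpha> j *\<^sub>R V j"
  have affine: "h (x + s *\<^sub>R V k) = h x + s * (h (x + V k) - h x)" for x s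
    using Suc.prems by (intro rank_one_affine) auto
  have "dir_D (V k) h x = h (x + V k) - h x" for x
  proof -
    have "((\<lambda>s. h (x + s *\<^sub>R V k)) has_real_derivative h (x + V k) - h x) (at 0)"
      unfolding affine by (auto intro!: derivative_eq_intros)
    then show ?thesis
      using dir_D_has_derivative[OF poly_ext_differentiable[OF ext]] DERIV_unique by blast
  qed
  then have "hbr h V (Suc k) \<alpha> x = h (x - ?c) - \<alpha> k * (h (x - ?c + V k) - h (x - ?c))" for x
    using Suc by (simp add: dir_D_translate)
  also have "\<dots> x = h (x - ?c + (- \<alpha> k) *\<^sub>R V k)" for x
    unfolding affine by simp
  finally show ?case by (auto simp: algebra_simps)
qed simp

section \<open>Compatibility of the families\<close>

lemma hbr_compatible:
  assumes fin: "\<And>j. j < m \<Longrightarrow> finite (VS j)" and cone: "\<And>j. j < m \<Longrightarrow> VS j \<subseteq> hyp_cone h e"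
    and F: "\<And>V t. V \<in> PiE {..<m} VS \<Longrightarrow> poly (F V) t = hbr h V m y (t *\<^sub>R e + w)"
  shows "compatible m VS F"
  unfolding compatible_def
proof (intro conjI ballI allI impI)
  fix s s' assume s: "s \<in> PiE {..<m} VS" and s': "s' \<in> PiE {..<m} VS"
  show "degree (F s) = degree (F s')" "sgn (lead_coeff (F s)) = sgn (lead_coeff (F s'))"
    using hbr_line[OF F[OF s]] hbr_line[OF F[OF s']] by simp_all
next
  fix p :: "nat \<Rightarrow> real^'n \<Rightarrow> real"
  assume p: "\<forall>j<m. (\<forall>a\<in>VS j. p j a \<ge> 0) \<and> (\<Sum>a\<in>VS j. p j a) = 1"
  show "real_rooted (\<Sum>s\<in>PiE {..<m} VS. smult (\<Prod>j<m. p j (s j)) (F s))"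
  \<comment> \<open>Instantiated with the means of the distributions \<open>p j\<close> as
    directions.\<close>
  proof (rule real_rooted_hbr)
    show "u + b *\<^sub>R (\<Sum>a\<in>VS j. p j a *\<^sub>R a) \<in> adm" if "j < m" "u \<in> adm" "b \<ge> 0" for j u b
      using that fin cone p by (intro adm_add_sum) auto
    show "poly (\<Sum>s\<in>PiE {..<m} VS. smult (\<Prod>j<m. p j (s j)) (F s)) t
        = hbr h (\<lambda>j. \<Sum>a\<in>VS j. p j a *\<^sub>R a) m y (t *\<^sub>R e + w)" for t
      using fin p by (subst hbr_expectation[symmetric]) (auto simp: poly_sum F)
  qed
qed

end

theorem theorem3p5:
  fixes h :: "real^'n \<Rightarrow> real" and e :: "real^'n"
    and m :: nat and VS :: "nat \<Rightarrow> (real^'n) set"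
  assumes hyp: "hyperbolic h e"
    and fin: "\<forall>j<m. finite (VS j)"
    and cone: "\<forall>j<m. VS j \<subseteq> hyp_cone h e"
  shows "(\<forall>(wx :: real^'n) (wy :: nat \<Rightarrow> real) (F :: (nat \<Rightarrow> real^'n) \<Rightarrow> real poly).
            (\<forall>V\<in>PiE {..<m} VS. \<forall>t. poly (F V) t = hbr h V m wy (t *\<^sub>R e + wx))
            \<longrightarrow> compatible m VS F)
       \<and> ((\<forall>j<m. \<forall>v\<in>VS j. hyp_rank h e v \<le> 1) \<longrightarrow>
          (\<forall>(w :: real^'n) (\<alpha> :: nat \<Rightarrow> real) (G :: (nat \<Rightarrow> real^'n) \<Rightarrow> real poly).
            (\<forall>V\<in>PiE {..<m} VS. \<forall>t. poly (G V) t = h (t *\<^sub>R e + w - (\<Sum>j<m. \<alpha> j *\<^sub>R V j)))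
            \<longrightarrow> compatible m VS G))"
proof -
  obtain d where "homog_poly d h" using hyp by (auto simp: hyperbolic_def)
  then obtain H where H: "poly_ext (Suc d) h H" "\<And>c z. H (c *s z) = c ^ d * H z"
    using homog_poly_ext by blast
  interpret hyperbolic_ext h H e d
    using hyp H by unfold_locales (auto simp: hyperbolic_def)
  have first: "compatible m VS F"
    if "\<forall>V\<in>PiE {..<m} VS. \<forall>t. poly (F V) t = hbr h V m wy (t *\<^sub>R e + wx)"
    for wx wy and F :: "(nat \<Rightarrow> real^'n) \<Rightarrow> real poly"
    using that fin cone by (intro hbr_compatible) auto
  \<comment> \<open>The second family is the first one with y = \<alpha>, by
    \<open>hbr_rank_one\<close>.\<close>
  have second: "compatible m VS G"
    if rank: "\<forall>j<m. \<forall>v\<in>VS j. hyp_rank h e v \<le> 1"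
      and G: "\<forall>V\<in>PiE {..<m} VS. \<forall>t. poly (G V) t = h (t *\<^sub>R e + w - (\<Sum>j<m. \<alpha> j *\<^sub>R V j))"
    for w \<alpha> and G :: "(nat \<Rightarrow> real^'n) \<Rightarrow> real poly"
  proof (rule first, intro ballI allI)
    fix V t assume V: "V \<in> PiE {..<m} VS"
    have "hbr h V m \<alpha> = (\<lambda>x. h (x - (\<Sum>j<m. \<alpha> j *\<^sub>R V j)))"
      using V rank cone by (intro hbr_rank_one) (auto simp: PiE_iff subset_iff)
    then show "poly (G V) t = hbr h V m \<alpha> (t *\<^sub>R e + w)"
      using G V by simp
  qed
  show ?thesis
    by (intro conjI allI impI) (erule first, erule (1) second)
qed

end
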